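(* The integral $$\mathcal C_{\mathrm{res}}:=\frac{1}{\Gamma(\tfrac14)^4\pi^2}\int_\Omega(\tau_{13}\tau_{14}\tau_{23}\tau_{24})^{-3/4}(c_1c_2c_3c_4)^{-1/2}\,d\boldsymbol\tau$$ converges, and $$\mathcal C_{\mathrm{res}}=\frac{\Gamma(\tfrac14)^4}{2\pi^4}=\frac{2}{\Gamma(\tfrac34)^4}=0.8869411685781154\ldots.$$
   Context: $\Omega\subset[0,\infty)^4$ is the set of $\boldsymbol\tau=(\tau_{13},\tau_{14},\tau_{23},\tau_{24})$ with non-negative coordinates for which the four quantities $$c_1=1-\tau_{13}-\tau_{14},\quad c_2=1-\tau_{23}-\tau_{24},\quad c_3=1-\tau_{13}-\tau_{23},\quad c_4=1-\tau_{14}-\tau_{24}$$ are all strictly positive. *)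

theory Defs
  imports "HOL-Analysis.Analysis"
begin

text \<open>A point of the real 4-space is a nested tuple
  \<open>(t13, t14, t23, t24) :: real \<times> real \<times> real \<times> real\<close>; \<open>lborel\<close> on this
  type is four-dimensional Lebesgue measure (restricted to the Borel sets).\<close>

definition c1 :: "real \<times> real \<times> real \<times> real \<Rightarrow> real" where
  "c1 = (\<lambda>(t13, t14, t23, t24). 1 - t13 - t14)"

definition c2 :: "real \<times> real \<times> real \<times> real \<Rightarrow> real" where
  "c2 = (\<lambda>(t13, t14, t23, t24). 1 - t23 - t24)"

definition c3 :: "real \<times> real \<times> real \<times> real \<Rightarrow> real" where
  "c3 = (\<lambda>(t13, t14, t23, t24). 1 - t13 - t23)"

definition c4 :: "real \<times> real \<times> real \<times> real \<Rightarrow> real" where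
  "c4 = (\<lambda>(t13, t14, t23, t24). 1 - t14 - t24)"

definition Omega :: "(real \<times> real \<times> real \<times> real) set" where
  "Omega = {(t13, t14, t23, t24) | t13 t14 t23 t24.
      0 \<le> t13 \<and> 0 \<le> t14 \<and> 0 \<le> t23 \<and> 0 \<le> t24 \<and>
      0 < c1 (t13, t14, t23, t24) \<and> 0 < c2 (t13, t14, t23, t24) \<and>
      0 < c3 (t13, t14, t23, t24) \<and> 0 < c4 (t13, t14, t23, t24)}"

text \<open>Where some coordinate vanishes the integrand is singular; \<open>0 powr a = 0\<close> gives it
  the value 0 there. That part of \<open>Omega\<close> is Lebesgue-null. On all of \<open>Omega\<close> the two bases
  are non-negative, so \<open>powr\<close> is the usual real power wherever the integrand is defined.\<close>

definition res_integrand :: "real \<times> real \<times> real \<times> real \<Rightarrow> real" where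
  "res_integrand = (\<lambda>(t13, t14, t23, t24).
     (t13 * t14 * t23 * t24) powr (- 3 / 4) *
     (c1 (t13, t14, t23, t24) * c2 (t13, t14, t23, t24) *
      c3 (t13, t14, t23, t24) * c4 (t13, t14, t23, t24)) powr (- 1 / 2))"

definition C_res :: real where
  "C_res = 1 / (Gamma (1 / 4) ^ 4 * pi ^ 2) *
     set_lebesgue_integral lborel Omega res_integrand"

end

theory Submission
  imports Defs
begin

text \<open>
  All integrands are non-negative, so everything is done with \<open>[0, \<infinity>]\<close>-valued integrals and Tonelli.
  Let \<open>\<beta> = B(1/2, 1/4)\<close>; the claim is that the integral over \<open>Omega\<close> equals \<open>2 \<beta>\<^sup>4\<close>.
  The four variables form a cycle in which 13 and 24 are opposite, so for fixed
  \<open>x = 1 - \<tau>\<^sub>1\<^sub>3\<close> and \<open>y = 1 - \<tau>\<^sub>2\<^sub>4\<close> the integral over the other two is a square \<open>F(x, y)\<^sup>2\<close>.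
  By homogeneity \<open>F\<close> reduces to a function \<open>G\<close> of \<open>z = x / y\<close>, and the integral over \<open>y\<close> is
  \<open>\<beta> (1 - z)\<^sup>-\<^sup>1\<^sup>/\<^sup>2\<close>. Expanding \<open>G(z)\<^sup>2\<close> as a double integral and integrating over \<open>z\<close> first gives a
  symmetric kernel to which the same homogeneity argument applies, producing a second factor \<open>\<beta>\<close>.
  What is left is the double integral of \<open>(r (1 - r) w (1 - w) (1 - r w))\<^sup>-\<^sup>1\<^sup>/\<^sup>2\<close>; with
  \<open>r = tanh\<^sup>2 u\<close> and \<open>w = tanh\<^sup>2 v\<close> it becomes the integral of
  \<open>(cosh (u + v) cosh (u - v))\<^sup>-\<^sup>1\<^sup>/\<^sup>2\<close> over the plane, which is \<open>\<beta>\<^sup>2 / 2\<close>.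
  For the decimal expansion, \<open>\<beta> = sqrt 2 * pi * S\<close> where \<open>S\<close> is the hypergeometric series of the
  complete elliptic integral at \<open>k\<^sup>2 = 1/2\<close>, whence \<open>C_res = 2 S\<^sup>2 / pi\<close>.
\<close>

subsection \<open>Substitutions in non-negative integrals\<close>

text \<open>Vanishing off the positive half-line encodes the domain of integration in the integrand,
  so that all integrals below range over the whole line.\<close>

definition pos_powr :: "real \<Rightarrow> real \<Rightarrow> ennreal" where
  "pos_powr a x = (if 0 < x then ennreal (x powr a) else 0)"

lemma pos_powr_measurable [measurable]: "pos_powr a \<in> borel_measurable borel"
  unfolding pos_powr_def by measurable

lemma pos_powr_nonpos [simp]: "x \<le> 0 \<Longrightarrow> pos_powr a x = 0"
  by (simp add: pos_powr_def)

lemma pos_powr_pos: "0 < x \<Longrightarrow> pos_powr a x = ennreal (x powr a)"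
  by (simp add: pos_powr_def)

lemma pos_powr_mult: "0 < x \<Longrightarrow> pos_powr a (x * y) = pos_powr a x * pos_powr a y"
  by (auto simp: pos_powr_def powr_mult ennreal_mult zero_less_mult_iff)

lemma nn_integral_lborel_swap:
  fixes f :: "real \<Rightarrow> real \<Rightarrow> ennreal"
  assumes [measurable]: "(\<lambda>(x, y). f x y) \<in> borel_measurable (borel \<Otimes>\<^sub>M borel)"
  shows "(\<integral>\<^sup>+x. \<integral>\<^sup>+y. f x y \<partial>lborel \<partial>lborel) = (\<integral>\<^sup>+y. \<integral>\<^sup>+x. f x y \<partial>lborel \<partial>lborel)"
  by (rule lborel_pair.Fubini'[symmetric]) measurable

lemma nn_integral_reflect:
  fixes f :: "real \<Rightarrow> ennreal"
  assumes [measurable]: "f \<in> borel_measurable borel"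
  shows "(\<integral>\<^sup>+x. f x \<partial>lborel) = (\<integral>\<^sup>+x. f (1 - x) \<partial>lborel)"
  by (subst nn_integral_real_affine[where c = "-1" and t = 1]) simp_all

lemma nn_integral_scale:
  fixes f :: "real \<Rightarrow> ennreal"
  assumes [measurable]: "f \<in> borel_measurable borel" and "0 < c"
  shows "(\<integral>\<^sup>+x. f x \<partial>lborel) = ennreal c * (\<integral>\<^sup>+x. f (c * x) \<partial>lborel)"
  using \<open>0 < c\<close> by (subst nn_integral_real_affine[where c = c and t = 0]) simp_all

text \<open>The diagonal is a null set and symmetry makes the two remaining half-planes contribute
  equally. In one of them the smaller variable is \<open>y * z\<close> with Jacobian
  \<open>y\<close>; the vanishing hypothesis confines the integral to \<open>0 < y\<close> and
  \<open>0 < z < 1\<close>. For a homogeneous kernel this separates the scale \<open>y\<close> from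
  the ratio \<open>z\<close>.\<close>

lemma nn_integral_symmetric:
  fixes g :: "real \<Rightarrow> real \<Rightarrow> ennreal"
  assumes [measurable]: "(\<lambda>(x, y). g x y) \<in> borel_measurable (borel \<Otimes>\<^sub>M borel)"
    and sym: "\<And>x y. g x y = g y x" and zero: "\<And>x y. x \<le> 0 \<Longrightarrow> g x y = 0"
  shows "(\<integral>\<^sup>+x. \<integral>\<^sup>+y. g x y \<partial>lborel \<partial>lborel) =
    2 * (\<integral>\<^sup>+z. indicator {0<..<1} z * (\<integral>\<^sup>+y. indicator {0<..} y * (ennreal y * g (y * z) y) \<partial>lborel) \<partial>lborel)"
proof -
  have "(\<integral>\<^sup>+x. \<integral>\<^sup>+y. g x y \<partial>lborel \<partial>lborel) =
    (\<integral>\<^sup>+x. (\<integral>\<^sup>+y. (if x < y then g x y else 0) \<partial>lborel) + (\<integral>\<^sup>+y. (if y < x then g x y else 0) \<partial>lborel) \<partial>lborel)"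
  proof (rule nn_integral_cong)
    fix x :: real
    have "(\<integral>\<^sup>+y. g x y \<partial>lborel) = (\<integral>\<^sup>+y. (if x < y then g x y else 0) + (if y < x then g x y else 0) \<partial>lborel)"
      using AE_lborel_singleton[of x] by (intro nn_integral_cong_AE) auto
    then show "(\<integral>\<^sup>+y. g x y \<partial>lborel) =
      (\<integral>\<^sup>+y. (if x < y then g x y else 0) \<partial>lborel) + (\<integral>\<^sup>+y. (if y < x then g x y else 0) \<partial>lborel)"
      by (simp add: nn_integral_add)
  qed
  also have "\<dots> = (\<integral>\<^sup>+x. \<integral>\<^sup>+y. (if x < y then g x y else 0) \<partial>lborel \<partial>lborel)
      + (\<integral>\<^sup>+x. \<integral>\<^sup>+y. (if y < x then g x y else 0) \<partial>lborel \<partial>lborel)"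
    by (rule nn_integral_add) measurable
  also have "(\<integral>\<^sup>+x. \<integral>\<^sup>+y. (if x < y then g x y else 0) \<partial>lborel \<partial>lborel)
      = (\<integral>\<^sup>+x. \<integral>\<^sup>+y. (if y < x then g x y else 0) \<partial>lborel \<partial>lborel)"
    by (subst nn_integral_lborel_swap) (measurable, intro nn_integral_cong if_cong refl sym)
  also have "(\<integral>\<^sup>+x. \<integral>\<^sup>+y. (if y < x then g x y else 0) \<partial>lborel \<partial>lborel)
     = (\<integral>\<^sup>+y. \<integral>\<^sup>+z. indicator {0<..<1} z * (indicator {0<..} y * (ennreal y * g (y * z) y)) \<partial>lborel \<partial>lborel)"
  proof (rule nn_integral_cong)
    fix y :: real
    show "(\<integral>\<^sup>+x. (if x < y then g y x else 0) \<partial>lborel)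
      = (\<integral>\<^sup>+z. indicator {0<..<1} z * (indicator {0<..} y * (ennreal y * g (y * z) y)) \<partial>lborel)"
    proof (cases "0 < y")
      case True
      then have "(\<integral>\<^sup>+x. (if x < y then g y x else 0) \<partial>lborel)
        = ennreal y * (\<integral>\<^sup>+z. (if y * z < y then g y (y * z) else 0) \<partial>lborel)"
        by (subst nn_integral_scale[where c = y]) simp_all
      also have "\<dots> = (\<integral>\<^sup>+z. ennreal y * (if y * z < y then g y (y * z) else 0) \<partial>lborel)"
        by (rule nn_integral_cmult[symmetric]) measurable
      also have "\<dots> = (\<integral>\<^sup>+z. indicator {0<..<1} z * (indicator {0<..} y * (ennreal y * g (y * z) y)) \<partial>lborel)"
        using True zero
        by (intro nn_integral_cong)
          (auto simp: sym[of y] indicator_def mult_le_0_iff not_less)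
      finally show ?thesis .
    next
      case False
      then show ?thesis using zero by (simp add: indicator_def cong: if_cong)
    qed
  qed
  also have "\<dots> = (\<integral>\<^sup>+z. \<integral>\<^sup>+y. indicator {0<..<1} z * (indicator {0<..} y * (ennreal y * g (y * z) y)) \<partial>lborel \<partial>lborel)"
    by (rule nn_integral_lborel_swap) measurable
  also have "\<dots> = (\<integral>\<^sup>+z. indicator {0<..<1} z * (\<integral>\<^sup>+y. indicator {0<..} y * (ennreal y * g (y * z) y) \<partial>lborel) \<partial>lborel)"
    by (intro nn_integral_cong nn_integral_cmult) measurable
  finally show ?thesis by (simp add: mult_2)
qed

text \<open>The map \<open>w / (c + (1 - c) * w)\<close> increases from 0 to 1 on the unit interval
  and has derivative \<open>c / (c + (1 - c) * w)^2\<close>. It is the substitution behind Euler's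
  transformation: it sends a factor \<open>1 - z\<close> to \<open>c * (1 - w)\<close> over the
  common denominator.\<close>

lemma nn_integral_moebius:
  fixes f :: "real \<Rightarrow> ennreal"
  assumes [measurable]: "f \<in> borel_measurable borel" and c: "0 < c"
    and zero: "\<And>z. z \<le> 0 \<or> 1 \<le> z \<Longrightarrow> f z = 0"
  shows "(\<integral>\<^sup>+z. f z \<partial>lborel) =
    (\<integral>\<^sup>+w. indicator {0<..<1} w * (f (w / (c + (1 - c) * w)) * ennreal (c / (c + (1 - c) * w)\<^sup>2)) \<partial>lborel)"
proof -
  define g where "g w = w / (c + (1 - c) * w)" for w
  have pos: "0 < c + (1 - c) * w" if "w \<in> {0..1}" for w
  proof -
    have "c + (1 - c) * w = c * (1 - w) + w" by algebra
    then show ?thesis using c that by (cases "w = 1") (auto intro!: add_pos_nonneg)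
  qed
  have "(\<integral>\<^sup>+z. f z \<partial>lborel) = (\<integral>\<^sup>+z. f z * indicator {g 0..g 1} z \<partial>lborel)"
    using zero by (intro nn_integral_cong) (auto simp: g_def indicator_def not_le)
  also have "\<dots> = (\<integral>\<^sup>+w. f (g w) * ennreal (c / (c + (1 - c) * w)\<^sup>2) * indicator {0..1} w \<partial>lborel)"
  proof (rule nn_integral_substitution_aux)
    fix w :: real assume w: "w \<in> {0..1}"
    show "(g has_real_derivative c / (c + (1 - c) * w)\<^sup>2) (at w)"
      unfolding g_def using pos[OF w]
      by (auto intro!: derivative_eq_intros simp: power2_eq_square field_simps)
    show "0 \<le> c / (c + (1 - c) * w)\<^sup>2" using c by simp
  next
    show "continuous_on {0..1} (\<lambda>w. c / (c + (1 - c) * w)\<^sup>2)"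
      using pos by (intro continuous_intros) force
  qed simp_all
  also have "\<dots> = (\<integral>\<^sup>+w. indicator {0<..<1} w * (f (g w) * ennreal (c / (c + (1 - c) * w)\<^sup>2)) \<partial>lborel)"
    using zero by (intro nn_integral_cong) (auto simp: g_def indicator_def)
  finally show ?thesis by (simp add: g_def)
qed

lemma nn_integral_even:
  fixes f :: "real \<Rightarrow> ennreal"
  assumes [measurable]: "f \<in> borel_measurable borel" and even: "\<And>x. f (- x) = f x"
  shows "(\<integral>\<^sup>+x. f x \<partial>lborel) = 2 * (\<integral>\<^sup>+x. f x * indicator {0..} x \<partial>lborel)"
proof -
  have "(\<integral>\<^sup>+x. f x \<partial>lborel) = (\<integral>\<^sup>+x. f x * indicator {0..} x + f x * indicator {..0} x \<partial>lborel)"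
    using AE_lborel_singleton[of 0] by (intro nn_integral_cong_AE) (auto simp: indicator_def)
  also have "\<dots> = (\<integral>\<^sup>+x. f x * indicator {0..} x \<partial>lborel) + (\<integral>\<^sup>+x. f x * indicator {..0} x \<partial>lborel)"
    by (rule nn_integral_add) measurable
  also have "(\<integral>\<^sup>+x. f x * indicator {..0} x \<partial>lborel) = (\<integral>\<^sup>+x. f x * indicator {0..} x \<partial>lborel)"
    by (subst nn_integral_real_affine[where c = "-1" and t = 0])
      (auto simp: even indicator_def intro!: nn_integral_cong)
  finally show ?thesis by (simp add: mult_2)
qed

lemma tanh_cosh_measurable [measurable]:
  "(tanh :: real \<Rightarrow> real) \<in> borel_measurable borel"
  "(cosh :: real \<Rightarrow> real) \<in> borel_measurable borel"
  by (intro borel_measurable_continuous_onI continuous_intros; simp)+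

text \<open>The new variable runs over an unbounded half-line, so the substitution is made on
  \<open>{0..real n}\<close> and both sides pass to the limit by monotone convergence, since tanh
  tends to 1.\<close>

lemma nn_integral_substitution_tanh_square:
  fixes f :: "real \<Rightarrow> ennreal"
  assumes [measurable]: "f \<in> borel_measurable borel"
    and zero: "\<And>z. z \<le> 0 \<or> 1 \<le> z \<Longrightarrow> f z = 0"
  shows "(\<integral>\<^sup>+z. f z \<partial>lborel) =
    (\<integral>\<^sup>+u. f ((tanh u)\<^sup>2) * ennreal (2 * tanh u * (1 - (tanh u)\<^sup>2)) * indicator {0..} u \<partial>lborel)"
proof -
  let ?g' = "\<lambda>u::real. 2 * tanh u * (1 - (tanh u)\<^sup>2)"
  let ?A = "\<lambda>n z. f z * indicator {(tanh 0)\<^sup>2..(tanh (real n))\<^sup>2} z"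
  let ?B = "\<lambda>n u. f ((tanh u)\<^sup>2) * ennreal (?g' u) * indicator {0..real n} u"
  have eq: "integral\<^sup>N lborel (?A n) = integral\<^sup>N lborel (?B n)" if "0 < n" for n
  proof (rule nn_integral_substitution_aux)
    fix u :: real assume u: "u \<in> {0..real n}"
    show "((\<lambda>u. (tanh u)\<^sup>2) has_real_derivative ?g' u) (at u)"
      using cosh_real_pos[of u] by (auto intro!: derivative_eq_intros)
    show "0 \<le> ?g' u"
      using u tanh_real_bounds[of u] by (intro mult_nonneg_nonneg) (auto simp: abs_square_le_1)
  next
    show "continuous_on {0..real n} ?g'" by (intro continuous_intros) auto
  qed (use that in simp_all)
  have limA: "(\<lambda>n. integral\<^sup>N lborel (?A n)) \<longlonglongrightarrow> integral\<^sup>N lborel f"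
  proof (rule nn_integral_LIMSEQ)
    show "incseq ?A"
      by (auto simp: incseq_def le_fun_def indicator_def intro: order_trans)
  next
    fix z
    show "(\<lambda>n. ?A n z) \<longlonglongrightarrow> f z"
    proof (cases "0 < z \<and> z < 1")
      case True
      have "((\<lambda>n. (tanh (real n))\<^sup>2) \<longlongrightarrow> 1\<^sup>2) sequentially"
        by (intro tendsto_intros filterlim_compose[OF tanh_real_at_top filterlim_real_sequentially])
      then have "\<forall>\<^sub>F n in sequentially. z < (tanh (real n))\<^sup>2"
        using True by (auto dest: order_tendstoD)
      then show ?thesis
        using True by (intro tendsto_eventually) (auto elim!: eventually_mono)
    next
      case False
      then show ?thesis using zero by auto
    qed
  qed measurable
  have limB: "(\<lambda>n. integral\<^sup>N lborel (?B n)) \<longlonglongrightarrow>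
    (\<integral>\<^sup>+u. f ((tanh u)\<^sup>2) * ennreal (?g' u) * indicator {0..} u \<partial>lborel)"
  proof (rule nn_integral_LIMSEQ)
    show "incseq ?B"
      by (auto simp: incseq_def le_fun_def indicator_def intro: order_trans)
  next
    fix u :: real
    have "\<forall>\<^sub>F n in sequentially. u \<le> real n"
      using filterlim_real_sequentially by (auto simp: filterlim_at_top)
    then have "\<forall>\<^sub>F n in sequentially. ?B n u = f ((tanh u)\<^sup>2) * ennreal (?g' u) * indicator {0..} u"
      by eventually_elim (simp add: indicator_def)
    then show "(\<lambda>n. ?B n u) \<longlonglongrightarrow> f ((tanh u)\<^sup>2) * ennreal (?g' u) * indicator {0..} u"
      by (rule tendsto_eventually)
  qed measurable
  \<comment> \<open>The substitution rule needs a nondegenerate interval, so the equality was shown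
    for \<open>0 < n\<close> only; eventual equality suffices for the limits.\<close>
  have ev: "\<forall>\<^sub>F n in sequentially. integral\<^sup>N lborel (?A n) = integral\<^sup>N lborel (?B n)"
    using eventually_gt_at_top[of 0] by eventually_elim (rule eq)
  show ?thesis
    by (rule LIMSEQ_unique[OF limA]) (use limB in \<open>simp only: tendsto_cong[OF ev]\<close>)
qed

subsection \<open>Reduction of the cycle integral\<close>

definition beta :: ennreal where
  "beta = (\<integral>\<^sup>+y. pos_powr (-1/2) y * pos_powr (-3/4) (1 - y) \<partial>lborel)"

text \<open>Logarithms turn the claim into a linear identity between exponents: those of
  \<open>d\<close> add up to 1/2 + 3/4 + 3/4 - 2 = 0, those of \<open>c\<close> to 1 - 3/4 - 3/4 =
  -1/2. The next two lemmas are proved in the same way.\<close>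

lemma euler_jacobian:
  assumes "0 < c" "0 < d" "0 < w" "0 < v"
  shows "pos_powr (-1/2) (w / d) * (pos_powr (-3/4) (c * v / d) * pos_powr (-3/4) (c / d)) * ennreal (c / d\<^sup>2)
    = pos_powr (-1/2) c * (pos_powr (-1/2) w * pos_powr (-3/4) v)"
proof -
  let ?l = "(w / d) powr (-1/2) * ((c * v / d) powr (-3/4) * (c / d) powr (-3/4)) * (c / d\<^sup>2)"
  let ?r = "c powr (-1/2) * (w powr (-1/2) * v powr (-3/4))"
  have "ln ?l = ln ?r" using assms by (simp add: ln_mult ln_div ln_powr ln_realpow add_divide_distrib diff_divide_distrib)
  moreover have "0 < ?l" "0 < ?r" using assms by simp_all
  ultimately have "?l = ?r" by (simp only: ln_inj_iff)
  then show ?thesis using assms by (simp add: pos_powr_pos flip: ennreal_mult')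
qed

text \<open>Four inverse square roots contribute \<open>d^2\<close>, which cancels the Jacobian
  denominator exactly; this is what makes the elliptic kernel homogeneous.\<close>

lemma elliptic_jacobian:
  assumes "0 < t" "0 < d" "0 < w" "0 < v" "0 < p"
  shows "pos_powr (-1/2) (w / d) * (pos_powr (-1/2) (t * v / d) * (pos_powr (-1/2) (t * p / d) * pos_powr (-1/2) (t / d)))
      * ennreal (t / d\<^sup>2)
    = pos_powr (-1/2) t * (pos_powr (-1/2) w * (pos_powr (-1/2) v * pos_powr (-1/2) p))"
proof -
  let ?l = "(w / d) powr (-1/2) * ((t * v / d) powr (-1/2) * ((t * p / d) powr (-1/2) * (t / d) powr (-1/2))) * (t / d\<^sup>2)"
  let ?r = "t powr (-1/2) * (w powr (-1/2) * (v powr (-1/2) * p powr (-1/2)))"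
  have "ln ?l = ln ?r" using assms by (simp add: ln_mult ln_div ln_powr ln_realpow add_divide_distrib diff_divide_distrib)
  moreover have "0 < ?l" "0 < ?r" using assms by simp_all
  ultimately have "?l = ?r" by (simp only: ln_inj_iff)
  then show ?thesis using assms by (simp add: pos_powr_pos flip: ennreal_mult')
qed

lemma cycle_jacobian:
  assumes "0 < y" "0 < z" "0 < t" "0 < v" "0 < p"
  shows "ennreal (y * z) * (pos_powr (-3/4) (y * z * v) * (pos_powr (-1/2) (y * z * t) * pos_powr (-1/2) (y * p)))
    = pos_powr (-3/4) y * (pos_powr (-1/4) z * (pos_powr (-1/2) t * (pos_powr (-3/4) v * pos_powr (-1/2) p)))"
proof -
  let ?l = "(y * z) * ((y * z * v) powr (-3/4) * ((y * z * t) powr (-1/2) * (y * p) powr (-1/2)))"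
  let ?r = "y powr (-3/4) * (z powr (-1/4) * (t powr (-1/2) * (v powr (-3/4) * p powr (-1/2))))"
  have "ln ?l = ln ?r" using assms by (simp add: ln_mult ln_div ln_powr add_divide_distrib diff_divide_distrib)
  moreover have "0 < ?l" "0 < ?r" using assms by simp_all
  ultimately have "?l = ?r" by (simp only: ln_inj_iff)
  then show ?thesis using assms by (simp add: pos_powr_pos flip: ennreal_mult')
qed

text \<open>Euler's transformation of the hypergeometric function degenerates here to
  \<open>F(1/2, 3/4; 3/4; z) = (1 - z)\<^sup>-\<^sup>1\<^sup>/\<^sup>2\<close>, because the third parameter equals the second.\<close>

lemma beta_euler_transform:
  assumes z: "0 < z" "z < 1"
  shows "(\<integral>\<^sup>+y. pos_powr (-1/2) y * (pos_powr (-3/4) (1 - y) * pos_powr (-3/4) (1 - z * y)) \<partial>lborel)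
    = pos_powr (-1/2) (1 - z) * beta"
proof -
  let ?f = "\<lambda>y. pos_powr (-1/2) y * (pos_powr (-3/4) (1 - y) * pos_powr (-3/4) (1 - z * y))"
  let ?D = "\<lambda>w. 1 - z + z * w"
  have "integral\<^sup>N lborel ?f =
    (\<integral>\<^sup>+w. indicator {0<..<1} w * (?f (w / ?D w) * ennreal ((1 - z) / (?D w)\<^sup>2)) \<partial>lborel)"
    using z by (subst nn_integral_moebius[where c = "1 - z"]) auto
  also have "\<dots> = (\<integral>\<^sup>+w. pos_powr (-1/2) (1 - z) * (pos_powr (-1/2) w * pos_powr (-3/4) (1 - w)) \<partial>lborel)"
  proof (rule nn_integral_cong)
    fix w :: real
    show "indicator {0<..<1} w * (?f (w / ?D w) * ennreal ((1 - z) / (?D w)\<^sup>2))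
      = pos_powr (-1/2) (1 - z) * (pos_powr (-1/2) w * pos_powr (-3/4) (1 - w))"
    proof (cases "0 < w \<and> w < 1")
      case True
      have D: "0 < ?D w" using True z by (simp add: add_pos_pos)
      have 1: "1 - w / ?D w = (1 - z) * (1 - w) / ?D w"
        and 2: "1 - z * (w / ?D w) = (1 - z) / ?D w"
        using D by (simp_all add: field_simps)
      show ?thesis
        unfolding 1 2 using True z D by (subst euler_jacobian) simp_all
    qed auto
  qed
  also have "\<dots> = pos_powr (-1/2) (1 - z) * beta"
    unfolding beta_def by (rule nn_integral_cmult) measurable
  finally show ?thesis .
qed

section \<open>Kernels of the reduction: measurability, symmetry and homogeneity\<close>

definition cycle_kernel :: "real \<Rightarrow> real \<Rightarrow> ennreal" where
  "cycle_kernel x y =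
    (\<integral>\<^sup>+b. pos_powr (-3/4) b * (pos_powr (-1/2) (x - b) * pos_powr (-1/2) (y - b)) \<partial>lborel)"

text \<open>For \<open>0 < z < 1\<close> this is Euler's integral for B(1/4, 1/2) F(1/2, 1/4; 3/4;
  z), written in the reflected variable so that the last factor is
  \<open>1 - z + z * t\<close>.\<close>

definition hyp_kernel :: "real \<Rightarrow> ennreal" where
  "hyp_kernel z =
    (\<integral>\<^sup>+t. pos_powr (-1/2) t * (pos_powr (-3/4) (1 - t) * pos_powr (-1/2) (1 - z + z * t)) \<partial>lborel)"

text \<open>For positive arguments, x = z / (1 - z) turns this into the integral of (x (1 + t x) (1
  + s x))^(-1/2) over the positive half-line, which is homogeneous of degree -1/2 in (t, s).\<close>

definition ell_kernel :: "real \<Rightarrow> real \<Rightarrow> ennreal" where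
  "ell_kernel t s = (\<integral>\<^sup>+z. pos_powr (-1/2) z * (pos_powr (-1/2) (1 - z) *
    (pos_powr (-1/2) (1 - z + z * t) * pos_powr (-1/2) (1 - z + z * s))) \<partial>lborel)"

text \<open>For \<open>0 < r < 1\<close> this is twice the complete elliptic integral K with k^2 = 1
  - r.\<close>

definition ell_integral :: "real \<Rightarrow> ennreal" where
  "ell_integral r = (\<integral>\<^sup>+w. pos_powr (-1/2) w * (pos_powr (-1/2) (1 - w) *
    pos_powr (-1/2) (1 - w + w * r)) \<partial>lborel)"

lemma kernel_measurable [measurable]:
  "(\<lambda>(x, y). cycle_kernel x y) \<in> borel_measurable (borel \<Otimes>\<^sub>M borel)"
  "hyp_kernel \<in> borel_measurable borel"
  "(\<lambda>(x, y). ell_kernel x y) \<in> borel_measurable (borel \<Otimes>\<^sub>M borel)"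
  "ell_integral \<in> borel_measurable borel"
  unfolding cycle_kernel_def hyp_kernel_def ell_kernel_def ell_integral_def by measurable

lemma cycle_kernel_commute: "cycle_kernel x y = cycle_kernel y x"
  by (simp add: cycle_kernel_def mult.commute)

lemma cycle_kernel_nonpos: "x \<le> 0 \<Longrightarrow> cycle_kernel x y = 0"
proof -
  assume "x \<le> 0"
  then have "pos_powr (-3/4) b * (pos_powr (-1/2) (x - b) * pos_powr (-1/2) (y - b)) = 0" for b
    by (cases "b \<le> 0") auto
  then show ?thesis unfolding cycle_kernel_def by (simp only:) simp
qed

text \<open>The substitution b = y z (1 - t) makes every base a monomial in y and z times a function
  of t and z. The powers of y add up to 1 - 3/4 - 1/2 - 1/2 and those of z to 1 - 3/4 - 1/2.\<close>

lemma cycle_kernel_scale: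
  assumes y: "0 < y" and z: "0 < z" "z < 1"
  shows "cycle_kernel (y * z) y = pos_powr (-3/4) y * (pos_powr (-1/4) z * hyp_kernel z)"
proof -
  have yz: "0 < y * z" using y z by simp
  have "cycle_kernel (y * z) y = (\<integral>\<^sup>+t. ennreal (y * z) * (pos_powr (-3/4) (y * z * (1 - t)) *
    (pos_powr (-1/2) (y * z - y * z * (1 - t)) * pos_powr (-1/2) (y - y * z * (1 - t)))) \<partial>lborel)"
    unfolding cycle_kernel_def
    by (subst nn_integral_scale[OF _ yz], measurable, subst nn_integral_reflect, measurable)
      (rule nn_integral_cmult[symmetric], measurable)
  also have "\<dots> = (\<integral>\<^sup>+t. pos_powr (-3/4) y * (pos_powr (-1/4) z * (pos_powr (-1/2) t *
      (pos_powr (-3/4) (1 - t) * pos_powr (-1/2) (1 - z + z * t)))) \<partial>lborel)"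
  proof (rule nn_integral_cong)
    fix t :: real
    have 1: "y * z - y * z * (1 - t) = y * z * t" "y - y * z * (1 - t) = y * (1 - z + z * t)"
      by algebra+
    show "ennreal (y * z) * (pos_powr (-3/4) (y * z * (1 - t)) *
      (pos_powr (-1/2) (y * z - y * z * (1 - t)) * pos_powr (-1/2) (y - y * z * (1 - t))))
      = pos_powr (-3/4) y * (pos_powr (-1/4) z * (pos_powr (-1/2) t *
      (pos_powr (-3/4) (1 - t) * pos_powr (-1/2) (1 - z + z * t))))"
    proof (cases "0 < t \<and> t < 1")
      case True
      have "0 < 1 - z + z * t" using True z by (simp add: add_pos_pos)
      then show ?thesis
        unfolding 1 using True y z by (intro cycle_jacobian) simp_all
    next
      case False
      then show ?thesis
        unfolding 1 using yz by (auto simp: not_less mult_nonneg_nonpos)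
    qed
  qed
  also have "\<dots> = pos_powr (-3/4) y * (pos_powr (-1/4) z * hyp_kernel z)"
    unfolding hyp_kernel_def by (simp add: nn_integral_cmult)
  finally show ?thesis .
qed

text \<open>The fractional linear substitution with \<open>c = t\<close> turns
  \<open>1 - z + z * t\<close> into \<open>t / ?D w\<close> and leaves a single nontrivial factor
  depending on \<open>r\<close>.\<close>

lemma ell_kernel_scale:
  assumes t: "0 < t" and r: "0 < r"
  shows "ell_kernel (t * r) t = pos_powr (-1/2) t * ell_integral r"
proof -
  let ?f = "\<lambda>z. pos_powr (-1/2) z * (pos_powr (-1/2) (1 - z) *
    (pos_powr (-1/2) (1 - z + z * (t * r)) * pos_powr (-1/2) (1 - z + z * t)))"
  let ?D = "\<lambda>w. t + (1 - t) * w"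
  have "ell_kernel (t * r) t = 
    (\<integral>\<^sup>+w. indicator {0<..<1} w * (?f (w / ?D w) * ennreal (t / (?D w)\<^sup>2)) \<partial>lborel)"
    unfolding ell_kernel_def using t by (subst nn_integral_moebius[where c = t]) auto
  also have "\<dots> = (\<integral>\<^sup>+w. pos_powr (-1/2) t * (pos_powr (-1/2) w * (pos_powr (-1/2) (1 - w) *
    pos_powr (-1/2) (1 - w + w * r))) \<partial>lborel)"
  proof (rule nn_integral_cong)
    fix w :: real
    show "indicator {0<..<1} w * (?f (w / ?D w) * ennreal (t / (?D w)\<^sup>2))
      = pos_powr (-1/2) t * (pos_powr (-1/2) w * (pos_powr (-1/2) (1 - w) *
    pos_powr (-1/2) (1 - w + w * r)))"
    proof (cases "0 < w \<and> w < 1")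
      case True
      have "?D w = t * (1 - w) + w" by algebra
      then have D: "0 < ?D w" using True t by (simp add: add_pos_pos)
      have R: "0 < 1 - w + w * r" using True r by (simp add: add_pos_pos)
      have 1: "1 - w / ?D w = t * (1 - w) / ?D w"
        and 2: "1 - w / ?D w + w / ?D w * t = t / ?D w"
        and 3: "1 - w / ?D w + w / ?D w * (t * r) = t * (1 - w + w * r) / ?D w"
        using D by (simp_all add: divide_simps) (simp_all add: algebra_simps)
      show ?thesis
        \<comment> \<open>The left side of 1 is a subterm of the left sides of 2 and 3, so it has to
          be rewritten after them.\<close>
        unfolding 2 3 unfolding 1 using True t D R by (subst elliptic_jacobian) simp_all
    qed auto
  qed
  also have "\<dots> = pos_powr (-1/2) t * ell_integral r"
    unfolding ell_integral_def by (rule nn_integral_cmult) measurable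
  finally show ?thesis .
qed

text \<open>Once the opposite variables \<open>a\<close> and \<open>d\<close> are fixed, no factor
  contains both \<open>b\<close> and \<open>c\<close>, and each of the two enters through the same
  function. The inner double integral is therefore a square.\<close>

lemma nn_integral_cycle:
  "(\<integral>\<^sup>+a. \<integral>\<^sup>+b. \<integral>\<^sup>+c. \<integral>\<^sup>+d. pos_powr (-3/4) a * (pos_powr (-3/4) b * (pos_powr (-3/4) c * (pos_powr (-3/4) d *
      (pos_powr (-1/2) (1 - a - b) * (pos_powr (-1/2) (1 - c - d) *
      (pos_powr (-1/2) (1 - a - c) * pos_powr (-1/2) (1 - b - d)))))))
      \<partial>lborel \<partial>lborel \<partial>lborel \<partial>lborel)
    = (\<integral>\<^sup>+x. \<integral>\<^sup>+y. pos_powr (-3/4) (1 - x) * (pos_powr (-3/4) (1 - y) * (cycle_kernel x y)\<^sup>2) \<partial>lborel \<partial>lborel)"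
proof -
  let ?q = "pos_powr (-3/4)" and ?p = "pos_powr (-1/2)"
  let ?W = "\<lambda>a b c d. ?q a * (?q b * (?q c * (?q d *
      (?p (1 - a - b) * (?p (1 - c - d) * (?p (1 - a - c) * ?p (1 - b - d)))))))"
  have "(\<integral>\<^sup>+a. \<integral>\<^sup>+b. \<integral>\<^sup>+c. \<integral>\<^sup>+d. ?W a b c d \<partial>lborel \<partial>lborel \<partial>lborel \<partial>lborel)
    = (\<integral>\<^sup>+a. \<integral>\<^sup>+b. \<integral>\<^sup>+d. \<integral>\<^sup>+c. ?W a b c d \<partial>lborel \<partial>lborel \<partial>lborel \<partial>lborel)"
    by (intro nn_integral_cong nn_integral_lborel_swap) measurable
  also have "\<dots> = (\<integral>\<^sup>+a. \<integral>\<^sup>+d. \<integral>\<^sup>+b. \<integral>\<^sup>+c. ?W a b c d \<partial>lborel \<partial>lborel \<partial>lborel \<partial>lborel)"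
    by (intro nn_integral_cong nn_integral_lborel_swap) measurable
  also have "\<dots> = (\<integral>\<^sup>+a. \<integral>\<^sup>+d. ?q a * (?q d * (cycle_kernel (1 - a) (1 - d))\<^sup>2) \<partial>lborel \<partial>lborel)"
  proof (intro nn_integral_cong)
    fix a d :: real
    have "(\<integral>\<^sup>+b. \<integral>\<^sup>+c. ?W a b c d \<partial>lborel \<partial>lborel)
      = (\<integral>\<^sup>+b. \<integral>\<^sup>+c. (?q a * (?q d * (?q b * (?p (1 - a - b) * ?p (1 - d - b))))) *
          (?q c * (?p (1 - a - c) * ?p (1 - d - c))) \<partial>lborel \<partial>lborel)"
      by (intro nn_integral_cong) (simp add: algebra_simps)
    also have "\<dots> = (\<integral>\<^sup>+b. ?q a * (?q d * (?q b * (?p (1 - a - b) * ?p (1 - d - b)))) \<partial>lborel)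
        * cycle_kernel (1 - a) (1 - d)"
      unfolding cycle_kernel_def by (simp add: nn_integral_cmult nn_integral_multc)
    also have "\<dots> = ?q a * (?q d * cycle_kernel (1 - a) (1 - d)) * cycle_kernel (1 - a) (1 - d)"
      unfolding cycle_kernel_def by (simp add: nn_integral_cmult)
    finally show "(\<integral>\<^sup>+b. \<integral>\<^sup>+c. ?W a b c d \<partial>lborel \<partial>lborel)
      = ?q a * (?q d * (cycle_kernel (1 - a) (1 - d))\<^sup>2)"
      by (simp add: power2_eq_square mult_ac)
  qed
  also have "\<dots> = (\<integral>\<^sup>+x. \<integral>\<^sup>+d. ?q (1 - x) * (?q d * (cycle_kernel (1 - (1 - x)) (1 - d))\<^sup>2) \<partial>lborel \<partial>lborel)"
    by (rule nn_integral_reflect) measurable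
  also have "\<dots> = (\<integral>\<^sup>+x. \<integral>\<^sup>+y. ?q (1 - x) * (?q (1 - y) * (cycle_kernel (1 - (1 - x)) (1 - (1 - y)))\<^sup>2) \<partial>lborel \<partial>lborel)"
    by (intro nn_integral_cong nn_integral_reflect) measurable
  finally show ?thesis by simp
qed

text \<open>After x = y z the power of y is y * y^(-3/4) * y^(-3/4) = y^(-1/2). The remaining
  y-integral is the one evaluated by \<open>beta_euler_transform\<close>, which supplies
  \<open>beta\<close> and the weight in \<open>1 - z\<close>.\<close>

lemma cycle_to_hyp_kernel:
  "(\<integral>\<^sup>+x. \<integral>\<^sup>+y. pos_powr (-3/4) (1 - x) * (pos_powr (-3/4) (1 - y) * (cycle_kernel x y)\<^sup>2) \<partial>lborel \<partial>lborel)
    = 2 * (beta * (\<integral>\<^sup>+z. pos_powr (-1/2) z * (pos_powr (-1/2) (1 - z) * (hyp_kernel z)\<^sup>2) \<partial>lborel))"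
proof -
  let ?q = "pos_powr (-3/4)" and ?p = "pos_powr (-1/2)"
  let ?g = "\<lambda>x y. ?q (1 - x) * (?q (1 - y) * (cycle_kernel x y)\<^sup>2)"
  have inner: "(\<integral>\<^sup>+y. indicator {0<..} y * (ennreal y * ?g (y * z) y) \<partial>lborel)
      = ?p z * (hyp_kernel z)\<^sup>2 * (?p (1 - z) * beta)" if z: "0 < z" "z < 1" for z
  proof -
    have "indicator {0<..} y * (ennreal y * ?g (y * z) y)
      = ?p z * (hyp_kernel z)\<^sup>2 * (?p y * (?q (1 - y) * ?q (1 - z * y)))" for y
    proof (cases "0 < y")
      case True
      have 1: "ennreal y * (?q y * ?q y) = ?p y"
        using True by (simp add: pos_powr_pos powr_add[symmetric] powr_mult_base flip: ennreal_mult')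
      have 2: "pos_powr (-1/4) z * pos_powr (-1/4) z = ?p z"
        using z by (simp add: pos_powr_pos powr_add[symmetric] flip: ennreal_mult')
      have "indicator {0<..} y * (ennreal y * ?g (y * z) y)
        = (ennreal y * (?q y * ?q y)) * (pos_powr (-1/4) z * pos_powr (-1/4) z) * (hyp_kernel z)\<^sup>2
          * (?q (1 - y) * ?q (1 - z * y))"
        using True by (simp add: cycle_kernel_scale[OF True z] power2_eq_square mult_ac)
      then show ?thesis unfolding 1 2 by (simp add: mult_ac)
    qed auto
    then have "(\<integral>\<^sup>+y. indicator {0<..} y * (ennreal y * ?g (y * z) y) \<partial>lborel)
      = ?p z * (hyp_kernel z)\<^sup>2 * (\<integral>\<^sup>+y. ?p y * (?q (1 - y) * ?q (1 - z * y)) \<partial>lborel)"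
      by (simp add: nn_integral_cmult)
    then show ?thesis by (simp only: beta_euler_transform[OF z])
  qed
  have "(\<integral>\<^sup>+x. \<integral>\<^sup>+y. ?g x y \<partial>lborel \<partial>lborel) = 2 * (\<integral>\<^sup>+z. indicator {0<..<1} z *
      (\<integral>\<^sup>+y. indicator {0<..} y * (ennreal y * ?g (y * z) y) \<partial>lborel) \<partial>lborel)"
    by (rule nn_integral_symmetric)
      (measurable, auto simp: cycle_kernel_nonpos mult_ac cycle_kernel_commute)
  also have "(\<integral>\<^sup>+z. indicator {0<..<1} z *
      (\<integral>\<^sup>+y. indicator {0<..} y * (ennreal y * ?g (y * z) y) \<partial>lborel) \<partial>lborel)
    = (\<integral>\<^sup>+z. beta * (?p z * (?p (1 - z) * (hyp_kernel z)\<^sup>2)) \<partial>lborel)"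
  proof (rule nn_integral_cong)
    fix z :: real
    show "indicator {0<..<1} z * (\<integral>\<^sup>+y. indicator {0<..} y * (ennreal y * ?g (y * z) y) \<partial>lborel)
      = beta * (?p z * (?p (1 - z) * (hyp_kernel z)\<^sup>2))"
    proof (cases "0 < z \<and> z < 1")
      case True
      then show ?thesis using inner[of z] by (simp add: mult_ac)
    qed auto
  qed
  also have "\<dots> = beta * (\<integral>\<^sup>+z. ?p z * (?p (1 - z) * (hyp_kernel z)\<^sup>2) \<partial>lborel)"
    by (rule nn_integral_cmult) measurable
  finally show ?thesis .
qed

text \<open>The square is written as a double integral over t and s, and Tonelli moves the
  z-integral to the inside.\<close>

lemma hyp_kernel_to_ell_kernel:
  "(\<integral>\<^sup>+z. pos_powr (-1/2) z * (pos_powr (-1/2) (1 - z) * (hyp_kernel z)\<^sup>2) \<partial>lborel)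
   = (\<integral>\<^sup>+t. \<integral>\<^sup>+s. (pos_powr (-1/2) t * pos_powr (-3/4) (1 - t)) * ((pos_powr (-1/2) s * pos_powr (-3/4) (1 - s))
      * ell_kernel t s) \<partial>lborel \<partial>lborel)"
proof -
  let ?p = "pos_powr (-1/2)"
  let ?w = "\<lambda>t. ?p t * pos_powr (-3/4) (1 - t)"
  let ?A = "\<lambda>z t. ?w t * ?p (1 - z + z * t)"
  have hyp: "hyp_kernel z = (\<integral>\<^sup>+t. ?A z t \<partial>lborel)" for z
    by (simp add: hyp_kernel_def mult.assoc)
  have "(\<integral>\<^sup>+z. ?p z * (?p (1 - z) * (hyp_kernel z)\<^sup>2) \<partial>lborel)
    = (\<integral>\<^sup>+z. \<integral>\<^sup>+t. \<integral>\<^sup>+s. ?p z * (?p (1 - z) * (?A z t * ?A z s)) \<partial>lborel \<partial>lborel \<partial>lborel)"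
  proof (rule nn_integral_cong)
    fix z
    have "(\<integral>\<^sup>+t. \<integral>\<^sup>+s. ?p z * (?p (1 - z) * (?A z t * ?A z s)) \<partial>lborel \<partial>lborel)
      = (\<integral>\<^sup>+t. ?p z * (?p (1 - z) * (?A z t * hyp_kernel z)) \<partial>lborel)"
      unfolding hyp by (simp add: nn_integral_cmult)
    also have "\<dots> = ?p z * (?p (1 - z) * (hyp_kernel z * hyp_kernel z))"
      unfolding hyp by (simp add: nn_integral_cmult nn_integral_multc)
    finally show "?p z * (?p (1 - z) * (hyp_kernel z)\<^sup>2)
      = (\<integral>\<^sup>+t. \<integral>\<^sup>+s. ?p z * (?p (1 - z) * (?A z t * ?A z s)) \<partial>lborel \<partial>lborel)"
      by (simp add: power2_eq_square)
  qed
  also have "\<dots> = (\<integral>\<^sup>+t. \<integral>\<^sup>+z. \<integral>\<^sup>+s. ?p z * (?p (1 - z) * (?A z t * ?A z s)) \<partial>lborel \<partial>lborel \<partial>lborel)"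
    by (rule nn_integral_lborel_swap) measurable
  also have "\<dots> = (\<integral>\<^sup>+t. \<integral>\<^sup>+s. \<integral>\<^sup>+z. ?p z * (?p (1 - z) * (?A z t * ?A z s)) \<partial>lborel \<partial>lborel \<partial>lborel)"
    by (intro nn_integral_cong nn_integral_lborel_swap) measurable
  also have "\<dots> = (\<integral>\<^sup>+t. \<integral>\<^sup>+s. ?w t * (?w s * ell_kernel t s) \<partial>lborel \<partial>lborel)"
  proof (intro nn_integral_cong)
    fix t s
    have "(\<integral>\<^sup>+z. ?p z * (?p (1 - z) * (?A z t * ?A z s)) \<partial>lborel)
      = (\<integral>\<^sup>+z. ?w t * (?w s * (?p z * (?p (1 - z) * (?p (1 - z + z * t) * ?p (1 - z + z * s))))) \<partial>lborel)"
      by (intro nn_integral_cong) (simp add: mult_ac)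
    also have "\<dots> = ?w t * (?w s * ell_kernel t s)"
      unfolding ell_kernel_def by (simp add: nn_integral_cmult)
    finally show "(\<integral>\<^sup>+z. ?p z * (?p (1 - z) * (?A z t * ?A z s)) \<partial>lborel) = ?w t * (?w s * ell_kernel t s)" .
  qed
  finally show ?thesis .
qed

lemma ell_kernel_commute: "ell_kernel t s = ell_kernel s t"
  by (simp add: ell_kernel_def mult.commute)

text \<open>The homogeneity argument of \<open>cycle_to_hyp_kernel\<close> applies a second time and
  meets the same Euler integral.\<close>

lemma ell_kernel_to_ell_integral:
  "(\<integral>\<^sup>+t. \<integral>\<^sup>+s. (pos_powr (-1/2) t * pos_powr (-3/4) (1 - t)) * ((pos_powr (-1/2) s * pos_powr (-3/4) (1 - s))
      * ell_kernel t s) \<partial>lborel \<partial>lborel)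
    = 2 * (beta * (\<integral>\<^sup>+r. pos_powr (-1/2) r * (pos_powr (-1/2) (1 - r) * ell_integral r) \<partial>lborel))"
proof -
  let ?q = "pos_powr (-3/4)" and ?p = "pos_powr (-1/2)"
  let ?g = "\<lambda>t s. (?p t * ?q (1 - t)) * ((?p s * ?q (1 - s)) * ell_kernel t s)"
  have inner: "(\<integral>\<^sup>+t. indicator {0<..} t * (ennreal t * ?g (t * r) t) \<partial>lborel)
      = ?p r * ell_integral r * (?p (1 - r) * beta)" if r: "0 < r" "r < 1" for r
  proof -
    have "indicator {0<..} t * (ennreal t * ?g (t * r) t)
      = ?p r * ell_integral r * (?p t * (?q (1 - t) * ?q (1 - r * t)))" for t
    proof (cases "0 < t")
      case True
      \<comment> \<open>Three factors \<open>?p t\<close> arise, from the two weights and from the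
        kernel. Two of them cancel the Jacobian and the third is kept for
        \<open>beta_euler_transform\<close>.\<close>
      have 1: "ennreal t * (?p t * ?p t) = 1"
        using True by (simp add: pos_powr_pos powr_add[symmetric] powr_mult_base flip: ennreal_mult')
      have "indicator {0<..} t * (ennreal t * ?g (t * r) t)
        = (ennreal t * (?p t * ?p t)) * (?p r * ell_integral r * (?p t * (?q (1 - t) * ?q (1 - r * t))))"
        unfolding ell_kernel_scale[OF True r(1)] pos_powr_mult[OF True] using True by (simp add: mult_ac)
      then show ?thesis unfolding 1 by simp
    qed auto
    then have "(\<integral>\<^sup>+t. indicator {0<..} t * (ennreal t * ?g (t * r) t) \<partial>lborel)
      = ?p r * ell_integral r * (\<integral>\<^sup>+t. ?p t * (?q (1 - t) * ?q (1 - r * t)) \<partial>lborel)"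
      by (simp add: nn_integral_cmult)
    then show ?thesis by (simp only: beta_euler_transform[OF r])
  qed
  have "(\<integral>\<^sup>+t. \<integral>\<^sup>+s. ?g t s \<partial>lborel \<partial>lborel) = 2 * (\<integral>\<^sup>+r. indicator {0<..<1} r *
      (\<integral>\<^sup>+t. indicator {0<..} t * (ennreal t * ?g (t * r) t) \<partial>lborel) \<partial>lborel)"
  proof (rule nn_integral_symmetric)
    show "?g t s = ?g s t" for t s
      by (subst ell_kernel_commute) (simp add: mult_ac)
    show "(\<lambda>(t, s). ?g t s) \<in> borel_measurable (borel \<Otimes>\<^sub>M borel)" by measurable
    show "?g t s = 0" if "t \<le> 0" for t s using that by simp
  qed
  also have "(\<integral>\<^sup>+r. indicator {0<..<1} r *
      (\<integral>\<^sup>+t. indicator {0<..} t * (ennreal t * ?g (t * r) t) \<partial>lborel) \<partial>lborel)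
    = (\<integral>\<^sup>+r. beta * (?p r * (?p (1 - r) * ell_integral r)) \<partial>lborel)"
  proof (rule nn_integral_cong)
    fix r :: real
    show "indicator {0<..<1} r * (\<integral>\<^sup>+t. indicator {0<..} t * (ennreal t * ?g (t * r) t) \<partial>lborel)
      = beta * (?p r * (?p (1 - r) * ell_integral r))"
    proof (cases "0 < r \<and> r < 1")
      case True
      then show ?thesis using inner[of r] by (simp add: mult_ac)
    qed auto
  qed
  also have "\<dots> = beta * (\<integral>\<^sup>+r. ?p r * (?p (1 - r) * ell_integral r) \<partial>lborel)"
    by (rule nn_integral_cmult) measurable
  finally show ?thesis .
qed

section \<open>Hyperbolic coordinates\<close>

lemma one_minus_tanh_square: "1 - (tanh u)\<^sup>2 = 1 / (cosh u)\<^sup>2" for u :: real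
proof -
  have "1 - (tanh u)\<^sup>2 = ((cosh u)\<^sup>2 - (sinh u)\<^sup>2) / (cosh u)\<^sup>2"
    by (simp add: tanh_def power_divide diff_divide_distrib)
  then show ?thesis by (simp only: hyperbolic_pythagoras)
qed

text \<open>For r = tanh^2 u the weight (r (1 - r))^(-1/2) dr becomes 2 du / cosh u on the positive
  half-line. Evenness in u trades the factor 2 for the whole line.\<close>

lemma hyperbolic_parametrization:
  fixes h :: "real \<Rightarrow> ennreal"
  assumes [measurable]: "h \<in> borel_measurable borel"
  shows "(\<integral>\<^sup>+r. pos_powr (-1/2) r * (pos_powr (-1/2) (1 - r) * h r) \<partial>lborel)
    = (\<integral>\<^sup>+u. ennreal (1 / cosh u) * h ((tanh u)\<^sup>2) \<partial>lborel)"
proof -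
  let ?p = "pos_powr (-1/2)"
  have "(\<integral>\<^sup>+r. ?p r * (?p (1 - r) * h r) \<partial>lborel)
    = (\<integral>\<^sup>+u. ?p ((tanh u)\<^sup>2) * (?p (1 - (tanh u)\<^sup>2) * h ((tanh u)\<^sup>2))
        * ennreal (2 * tanh u * (1 - (tanh u)\<^sup>2)) * indicator {0..} u \<partial>lborel)"
    by (rule nn_integral_substitution_tanh_square) auto
  also have "\<dots> = (\<integral>\<^sup>+u. 2 * (ennreal (1 / cosh u) * h ((tanh u)\<^sup>2) * indicator {0..} u) \<partial>lborel)"
  \<comment> \<open>At u = 0 the left side is 0 by the convention in \<open>pos_powr\<close>, while
    the right side contains \<open>h 0\<close>; the equality therefore holds only almost
    everywhere.\<close>
  proof (rule nn_integral_cong_AE)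
    have "?p ((tanh u)\<^sup>2) * (?p (1 - (tanh u)\<^sup>2) * h ((tanh u)\<^sup>2)) * ennreal (2 * tanh u * (1 - (tanh u)\<^sup>2))
        * indicator {0..} u = 2 * (ennreal (1 / cosh u) * h ((tanh u)\<^sup>2) * indicator {0..} u)" if "u \<noteq> 0" for u :: real
    proof (cases "0 < u")
      case True
      have "(tanh u)\<^sup>2 powr (-1/2) * (1 / (cosh u)\<^sup>2) powr (-1/2) * (2 * tanh u * (1 / (cosh u)\<^sup>2))
        = 2 * (1 / cosh u)"
        using True cosh_real_pos[of u]
        by (simp add: powr_minus_divide powr_half_sqrt real_sqrt_divide field_simps power2_eq_square)
      then have "?p ((tanh u)\<^sup>2) * ?p (1 - (tanh u)\<^sup>2) * ennreal (2 * tanh u * (1 - (tanh u)\<^sup>2))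
        = 2 * ennreal (1 / cosh u)"
        unfolding one_minus_tanh_square using True cosh_real_pos[of u]
        by (simp add: pos_powr_pos flip: ennreal_mult' ennreal_numeral)
      then show ?thesis using True by (simp add: mult_ac)
    qed (use that in auto)
    then show "AE u in lborel. ?p ((tanh u)\<^sup>2) * (?p (1 - (tanh u)\<^sup>2) * h ((tanh u)\<^sup>2))
        * ennreal (2 * tanh u * (1 - (tanh u)\<^sup>2)) * indicator {0..} u
      = 2 * (ennreal (1 / cosh u) * h ((tanh u)\<^sup>2) * indicator {0..} u)"
      using AE_lborel_singleton[of 0] by auto
  qed
  also have "\<dots> = 2 * (\<integral>\<^sup>+u. ennreal (1 / cosh u) * h ((tanh u)\<^sup>2) * indicator {0..} u \<partial>lborel)"
    by (rule nn_integral_cmult) measurable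
  also have "\<dots> = (\<integral>\<^sup>+u. ennreal (1 / cosh u) * h ((tanh u)\<^sup>2) \<partial>lborel)"
    by (rule nn_integral_even[symmetric]) simp_all
  finally show ?thesis .
qed

text \<open>Splitting the exponent -3/4 as -1/2 - 1/4 isolates the weight of
  \<open>hyperbolic_parametrization\<close>; what is left is (cosh u)^(-2) to the power
  -1/4.\<close>

lemma beta_hyperbolic: "beta = (\<integral>\<^sup>+u. ennreal (1 / sqrt (cosh u)) \<partial>lborel)"
proof -
  have "beta = (\<integral>\<^sup>+r. pos_powr (-1/2) r * (pos_powr (-1/2) (1 - r) * pos_powr (-1/4) (1 - r)) \<partial>lborel)"
    unfolding beta_def
    by (intro nn_integral_cong) (auto simp: pos_powr_def simp flip: ennreal_mult' powr_add)
  also have "\<dots> = (\<integral>\<^sup>+u. ennreal (1 / cosh u) * pos_powr (-1/4) (1 - (tanh u)\<^sup>2) \<partial>lborel)"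
    by (rule hyperbolic_parametrization) measurable
  also have "\<dots> = (\<integral>\<^sup>+u. ennreal (1 / sqrt (cosh u)) \<partial>lborel)"
  proof (rule nn_integral_cong)
    fix u :: real
    have c: "0 < cosh u" by (rule cosh_real_pos)
    have sech: "1 - (tanh u)\<^sup>2 = cosh u powr (-2)"
      using c by (simp add: one_minus_tanh_square powr_minus_divide)
    have "(cosh u powr (-2)) powr (-1/4) = cosh u powr (1/2)"
      unfolding powr_powr by simp
    then have "1 / cosh u * (cosh u powr (-2)) powr (-1/4) = cosh u powr (-1) * cosh u powr (1/2)"
      using c by (simp add: powr_minus_divide)
    also have "\<dots> = cosh u powr (-(1/2))"
      by (simp only: powr_add[symmetric]) simp
    also have "\<dots> = 1 / sqrt (cosh u)"
      using c by (simp only: powr_minus_divide powr_half_sqrt less_imp_le)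
    finally show "ennreal (1 / cosh u) * pos_powr (-1/4) (1 - (tanh u)\<^sup>2) = ennreal (1 / sqrt (cosh u))"
      unfolding sech using c by (simp add: pos_powr_pos flip: ennreal_mult')
  qed
  finally show ?thesis .
qed

text \<open>The identity \<open>cosh (u + v) cosh (u - v) = cosh\<^sup>2 u cosh\<^sup>2 v - sinh\<^sup>2 u sinh\<^sup>2 v\<close>
  separates the variables \<open>u + v\<close> and \<open>u - v\<close>; the factor 2 is the Jacobian of that rotation.\<close>

lemma ell_integral_beta:
  "2 * (\<integral>\<^sup>+r. pos_powr (-1/2) r * (pos_powr (-1/2) (1 - r) * ell_integral r) \<partial>lborel) = beta\<^sup>2"
proof -
  let ?p = "pos_powr (-1/2)"
  define k :: "real \<Rightarrow> ennreal" where "k u = ennreal (1 / sqrt (cosh u))" for u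
  have [measurable]: "k \<in> borel_measurable borel" unfolding k_def by measurable
  \<comment> \<open>The reflection puts 1 - tanh^2 u into \<open>ell_integral\<close>, so that its
    last factor becomes 1 - tanh^2 u tanh^2 v, symmetric in u and v.\<close>
  have "(\<integral>\<^sup>+r. ?p r * (?p (1 - r) * ell_integral r) \<partial>lborel)
    = (\<integral>\<^sup>+r. ?p r * (?p (1 - r) * ell_integral (1 - r)) \<partial>lborel)"
    by (subst nn_integral_reflect) (simp_all add: mult_ac)
  also have "\<dots> = (\<integral>\<^sup>+u. ennreal (1 / cosh u) * ell_integral (1 - (tanh u)\<^sup>2) \<partial>lborel)"
    by (rule hyperbolic_parametrization) measurable
  also have "\<dots> = (\<integral>\<^sup>+u. \<integral>\<^sup>+v. k (u + v) * k (u - v) \<partial>lborel \<partial>lborel)"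
  proof (rule nn_integral_cong)
    fix u :: real
    have "ell_integral (1 - (tanh u)\<^sup>2) = (\<integral>\<^sup>+v. ennreal (1 / cosh v) *
        ?p (1 - (tanh v)\<^sup>2 + (tanh v)\<^sup>2 * (1 - (tanh u)\<^sup>2)) \<partial>lborel)"
      unfolding ell_integral_def by (rule hyperbolic_parametrization) measurable
    then have "ennreal (1 / cosh u) * ell_integral (1 - (tanh u)\<^sup>2) = (\<integral>\<^sup>+v. ennreal (1 / cosh u) * (ennreal (1 / cosh v) *
        ?p (1 - (tanh v)\<^sup>2 + (tanh v)\<^sup>2 * (1 - (tanh u)\<^sup>2))) \<partial>lborel)"
      by (simp add: nn_integral_cmult)
    also have "\<dots> = (\<integral>\<^sup>+v. k (u + v) * k (u - v) \<partial>lborel)"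
    proof (rule nn_integral_cong)
      fix v :: real
      have c: "0 < cosh u" "0 < cosh v" "0 < cosh (u + v)" "0 < cosh (u - v)" by (rule cosh_real_pos)+
      have 1: "cosh (u + v) * cosh (u - v) = (cosh u * cosh v)\<^sup>2 - (sinh u * sinh v)\<^sup>2"
        by (simp add: cosh_add cosh_diff algebra_simps power2_eq_square)
      have eq: "1 - (tanh v)\<^sup>2 + (tanh v)\<^sup>2 * (1 - (tanh u)\<^sup>2)
        = cosh (u + v) * cosh (u - v) / (cosh u * cosh v)\<^sup>2"
        unfolding 1 using c by (simp add: tanh_def power_divide power_mult_distrib diff_divide_distrib algebra_simps)
      show "ennreal (1 / cosh u) * (ennreal (1 / cosh v) *
        ?p (1 - (tanh v)\<^sup>2 + (tanh v)\<^sup>2 * (1 - (tanh u)\<^sup>2))) = k (u + v) * k (u - v)"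
        unfolding eq k_def using c
        by (simp add: pos_powr_pos powr_minus_divide powr_half_sqrt real_sqrt_divide real_sqrt_mult
            flip: ennreal_mult')
    qed
    finally show "ennreal (1 / cosh u) * ell_integral (1 - (tanh u)\<^sup>2) = (\<integral>\<^sup>+v. k (u + v) * k (u - v) \<partial>lborel)" .
  qed
  also have "\<dots> = (\<integral>\<^sup>+v. \<integral>\<^sup>+u. k (u + v) * k (u - v) \<partial>lborel \<partial>lborel)"
    by (rule nn_integral_lborel_swap) measurable
  \<comment> \<open>The linear change of variables is made one variable at a time: here a shift of u
    by v, later a scaling of v by -2.\<close>
  also have "\<dots> = (\<integral>\<^sup>+v. \<integral>\<^sup>+x. k x * k (x - 2 * v) \<partial>lborel \<partial>lborel)"
  proof (rule nn_integral_cong)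
    fix v :: real
    show "(\<integral>\<^sup>+u. k (u + v) * k (u - v) \<partial>lborel) = (\<integral>\<^sup>+x. k x * k (x - 2 * v) \<partial>lborel)"
      by (subst nn_integral_real_affine[where c = 1 and t = "-v"]) (simp_all add: algebra_simps)
  qed
  also have "\<dots> = (\<integral>\<^sup>+x. \<integral>\<^sup>+v. k x * k (x - 2 * v) \<partial>lborel \<partial>lborel)"
    by (rule nn_integral_lborel_swap) measurable
  also have "2 * \<dots> = (\<integral>\<^sup>+x. k x * (2 * (\<integral>\<^sup>+v. k (x - 2 * v) \<partial>lborel)) \<partial>lborel)"
    by (simp add: nn_integral_cmult mult_ac flip: nn_integral_cmult)
  also have "\<dots> = (\<integral>\<^sup>+x. k x * beta \<partial>lborel)"
  proof (rule nn_integral_cong)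
    fix x :: real
    have "beta = 2 * (\<integral>\<^sup>+v. k (x - 2 * v) \<partial>lborel)"
      unfolding beta_hyperbolic k_def[symmetric]
      by (subst nn_integral_real_affine[where c = "-2" and t = x]) simp_all
    then show "k x * (2 * (\<integral>\<^sup>+v. k (x - 2 * v) \<partial>lborel)) = k x * beta" by simp
  qed
  also have "\<dots> = beta\<^sup>2"
    by (simp add: nn_integral_multc power2_eq_square) (simp add: beta_hyperbolic k_def)
  finally show ?thesis .
qed

subsection \<open>Closed form\<close>

lemma nn_integral_Beta:
  assumes "0 < a" "0 < b"
  shows "(\<integral>\<^sup>+y. pos_powr (a - 1) y * pos_powr (b - 1) (1 - y) \<partial>lborel) = ennreal (Beta a b)"
proof -
  have "(\<integral>\<^sup>+y. ennreal (y powr (a - 1) * (1 - y) powr (b - 1)) * indicator {0..1} y \<partial>lborel) = ennreal (Beta a b)"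
    by (rule nn_integral_has_integral_lebesgue'[OF _ has_integral_Beta_real[OF assms]]) simp
  then show ?thesis
    by (subst (asm) nn_integral_cong[where v = "\<lambda>y. pos_powr (a - 1) y * pos_powr (b - 1) (1 - y)"])
      (auto simp: pos_powr_def indicator_def ennreal_mult')
qed

text \<open>Euler's reflection formula at 1/4, applied over the complex numbers and carried back to
  the reals.\<close>

lemma Gamma_quarter_reflection: "Gamma (1/4) * Gamma (3/4) = pi * sqrt (2 :: real)"
proof -
  have "complex_of_real (Gamma (1/4) * Gamma (3/4)) = Gamma (1/4) * Gamma (1 - 1/4)"
    by (simp flip: Gamma_complex_of_real)
  also have "\<dots> = of_real pi / sin (of_real pi * (1/4))"
    by (rule Gamma_reflection_complex)
  also have "of_real pi * (1/4) = complex_of_real (pi / 4)" by simp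
  also have "of_real pi / sin (complex_of_real (pi / 4)) = complex_of_real (pi / sin (pi / 4))"
    by (subst sin_of_real, rule of_real_divide[symmetric])
  finally have "Gamma (1/4) * Gamma (3/4) = pi / sin (pi / 4)"
    by (simp only: of_real_eq_iff)
  also have "pi / sin (pi / 4) = pi * (2 / sqrt 2)" by (simp add: sin_45)
  finally show ?thesis by (simp only: real_div_sqrt zero_le_numeral)
qed

lemma Gamma_three_quarters: "Gamma (3/4) = pi * sqrt 2 / Gamma (1/4 :: real)"
proof -
  have "Gamma (1/4) \<noteq> (0::real)" using Gamma_real_pos[of "1/4"] by linarith
  then have "Gamma (3/4) = (Gamma (1/4) * Gamma (3/4)) / Gamma (1/4 :: real)" by simp
  then show ?thesis by (simp only: Gamma_quarter_reflection)
qed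

lemma beta_eq: "beta = ennreal (Beta (1/2) (1/4))"
  using nn_integral_Beta[of "1/2" "1/4"] by (simp add: beta_def)

lemma Beta_quarter: "Beta (1/2) (1/4) = Gamma (1/4)^2 / sqrt (2 * pi :: real)"
proof -
  have "Gamma (1/4) \<noteq> (0::real)" using Gamma_real_pos[of "1/4"] by linarith
  then show ?thesis
    by (simp add: Gamma_three_quarters Beta_def Gamma_one_half_real real_sqrt_mult field_simps power2_eq_square)
qed

section \<open>From the iterated integral to the integral over \<open>Omega\<close>\<close>

lemma nn_integral_lborel_pair:
  fixes f :: "'a::euclidean_space \<times> 'b::euclidean_space \<Rightarrow> ennreal"
  assumes "f \<in> borel_measurable borel"
  shows "integral\<^sup>N lborel f = (\<integral>\<^sup>+x. \<integral>\<^sup>+y. f (x, y) \<partial>lborel \<partial>lborel)"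
  using lborel.nn_integral_fst[of f "lborel :: 'a measure"] assms by (simp add: lborel_prod borel_prod)

lemma nn_integral_res_integrand:
  "(\<integral>\<^sup>+p. ennreal (indicator Omega p * res_integrand p) \<partial>lborel) = 2 * beta ^ 4"
proof -
  let ?q = "pos_powr (-3/4)" and ?p = "pos_powr (-1/2)"
  let ?W = "\<lambda>(a, b, c, d). ?q a * (?q b * (?q c * (?q d *
      (?p (1 - a - b) * (?p (1 - c - d) * (?p (1 - a - c) * ?p (1 - b - d)))))))"
  have "ennreal (indicator Omega p * res_integrand p) = ?W p" for p
  proof -
    obtain a b c d where p: "p = (a, b, c, d)" by (metis prod.collapse)
    show ?thesis
    proof (cases "p \<in> Omega \<and> 0 < a \<and> 0 < b \<and> 0 < c \<and> 0 < d")
      case True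
      then show ?thesis
        by (simp add: p Omega_def res_integrand_def c1_def c2_def c3_def c4_def pos_powr_pos powr_mult
            mult_ac flip: ennreal_mult')
    next
      \<comment> \<open>Either the point lies outside \<open>Omega\<close> or one of its coordinates
        is 0. In the second case the conventions for a zero base agree on both sides, so the
        equality is pointwise.\<close>
      case False
      then have "indicator Omega p * res_integrand p = 0"
        by (auto simp: p Omega_def res_integrand_def indicator_def)
      moreover from False have "?W p = 0"
        by (auto simp: p Omega_def pos_powr_def c1_def c2_def c3_def c4_def)
      ultimately show ?thesis by (simp only: ennreal_0)
    qed
  qed
  then have "(\<integral>\<^sup>+p. ennreal (indicator Omega p * res_integrand p) \<partial>lborel) = (\<integral>\<^sup>+p. ?W p \<partial>lborel)"
    by simp
  also have "\<dots> = (\<integral>\<^sup>+a. \<integral>\<^sup>+b. \<integral>\<^sup>+c. \<integral>\<^sup>+d. ?W (a, b, c, d) \<partial>lborel \<partial>lborel \<partial>lborel \<partial>lborel)"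
  proof -
    have W: "?W \<in> borel_measurable borel"
      unfolding case_prod_beta borel_prod[symmetric] by measurable
    have "integral\<^sup>N lborel ?W = (\<integral>\<^sup>+a. \<integral>\<^sup>+p. ?W (a, p) \<partial>lborel \<partial>lborel)"
      by (rule nn_integral_lborel_pair[OF W])
    also have "\<dots> = (\<integral>\<^sup>+a. \<integral>\<^sup>+b. \<integral>\<^sup>+p. ?W (a, b, p) \<partial>lborel \<partial>lborel \<partial>lborel)"
      by (intro nn_integral_cong nn_integral_lborel_pair)
        (rule measurable_compose[OF borel_measurable_continuous_onI W], intro continuous_intros)
    also have "\<dots> = (\<integral>\<^sup>+a. \<integral>\<^sup>+b. \<integral>\<^sup>+c. \<integral>\<^sup>+d. ?W (a, b, c, d) \<partial>lborel \<partial>lborel \<partial>lborel \<partial>lborel)"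
      by (intro nn_integral_cong nn_integral_lborel_pair)
        (rule measurable_compose[OF borel_measurable_continuous_onI W], intro continuous_intros)
    finally show ?thesis .
  qed
  \<comment> \<open>Each of the two homogeneity reductions contributes \<open>2 * beta\<close>; one
    factor 2 is then used up by \<open>ell_integral_beta\<close>.\<close>
  also have "\<dots> = 2 * (beta * (2 * (beta * (\<integral>\<^sup>+r. ?p r * (?p (1 - r) * ell_integral r) \<partial>lborel))))"
    by (simp only: prod.case nn_integral_cycle cycle_to_hyp_kernel hyp_kernel_to_ell_kernel
        ell_kernel_to_ell_integral)
  also have "\<dots> = 2 * (beta * (beta * (2 * (\<integral>\<^sup>+r. ?p r * (?p (1 - r) * ell_integral r) \<partial>lborel))))"
    by (simp only: mult_ac)
  also have "\<dots> = 2 * beta ^ 4"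
    unfolding ell_integral_beta by (simp add: power2_eq_square power4_eq_xxxx mult_ac)
  finally show ?thesis .
qed

lemma Omega_measurable [measurable]: "Omega \<in> sets borel"
proof -
  have "Omega = {p. 0 \<le> fst p \<and> 0 \<le> fst (snd p) \<and> 0 \<le> fst (snd (snd p)) \<and> 0 \<le> snd (snd (snd p)) \<and>
    0 < c1 p \<and> 0 < c2 p \<and> 0 < c3 p \<and> 0 < c4 p}"
    by (auto simp: Omega_def)
  moreover have "Measurable.pred (borel :: (real \<times> real \<times> real \<times> real) measure) (\<lambda>p.
    0 \<le> fst p \<and> 0 \<le> fst (snd p) \<and> 0 \<le> fst (snd (snd p)) \<and> 0 \<le> snd (snd (snd p)) \<and>
    0 < c1 p \<and> 0 < c2 p \<and> 0 < c3 p \<and> 0 < c4 p)"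
    unfolding c1_def c2_def c3_def c4_def case_prod_beta borel_prod[symmetric] by measurable
  ultimately show ?thesis by (simp add: pred_def)
qed

lemma res_integrand_measurable [measurable]: "res_integrand \<in> borel_measurable borel"
  unfolding res_integrand_def c1_def c2_def c3_def c4_def case_prod_beta borel_prod[symmetric] by measurable

text \<open>For a non-negative measurable integrand, a finite \<open>nn_integral\<close> yields both
  convergence and the value.\<close>

lemma res_integrand_integral:
  shows "set_integrable lborel Omega res_integrand"
    and "set_lebesgue_integral lborel Omega res_integrand = Gamma (1/4) ^ 8 / (2 * pi\<^sup>2)"
proof -
  have nonneg: "0 \<le> res_integrand p" for p
    by (cases p) (simp add: res_integrand_def)
  have "2 * Beta (1/2) (1/4) ^ 4 = Gamma (1/4) ^ 8 / (2 * pi\<^sup>2 :: real)"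
  proof -
    have "sqrt (2 * pi) ^ 4 = (2 * pi)\<^sup>2"
      using power_mult[of "sqrt (2 * pi)" 2 2] by simp
    then show ?thesis by (simp add: Beta_quarter power_divide power_mult_distrib flip: power_mult)
  qed
  moreover have "2 * beta ^ 4 = ennreal (2 * Beta (1/2) (1/4) ^ 4)"
    by (simp add: beta_eq Beta_quarter ennreal_power ennreal_mult')
  ultimately have nn: "(\<integral>\<^sup>+p. ennreal (indicator Omega p *\<^sub>R res_integrand p) \<partial>lborel)
    = ennreal (Gamma (1/4) ^ 8 / (2 * pi\<^sup>2))"
    using nn_integral_res_integrand by simp
  show int: "set_integrable lborel Omega res_integrand"
    unfolding set_integrable_def
    by (rule integrableI_nonneg) (use nonneg nn in auto)
  show "set_lebesgue_integral lborel Omega res_integrand = Gamma (1/4) ^ 8 / (2 * pi\<^sup>2)"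
    unfolding set_lebesgue_integral_def
    by (rule integral_eq_nn_integral[THEN trans]) (use nonneg nn in auto)
qed

section \<open>Closed forms of the constant\<close>

lemma C_res_Gamma_quarter: "C_res = Gamma (1 / 4) ^ 4 / (2 * pi ^ 4)"
proof -
  have "Gamma (1/4) \<noteq> (0::real)" using Gamma_real_pos[of "1/4"] by linarith
  then show ?thesis
    unfolding C_res_def res_integrand_integral(2) by (simp add: field_simps eval_nat_numeral)
qed

lemma C_res_Gamma_three_quarters: "C_res = 2 / Gamma (3 / 4) ^ 4"
proof -
  have 2: "sqrt 2 ^ 4 = (4::real)"
    using power_mult[of "sqrt 2" 2 2] by simp
  show ?thesis
    unfolding C_res_Gamma_quarter Gamma_three_quarters power_divide power_mult_distrib 2 by simp
qed

lemma C_res_Beta: "C_res = Beta (1/2) (1/4) ^ 2 / pi ^ 3"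
  unfolding C_res_Gamma_quarter Beta_quarter
  by (simp add: power_divide field_simps eval_nat_numeral)

subsection \<open>Numerical value\<close>

text \<open>Machin's formula with partial sums of the alternating arctangent series; with these
  lengths the truncation error in pi is below 10^(-20).\<close>

lemma pi_bounds: "3.1415926535897932384 \<le> pi" "pi \<le> 3.1415926535897932385"
  unfolding pi_machin
  using arctan_bounds[of "1/5" 7] arctan_bounds[of "1/239" 3]
  by (simp_all add: eval_nat_numeral)

text \<open>The series with these terms is \<open>1 / AGM(1, 1 / sqrt 2)\<close>.\<close>

definition agm_term :: "nat \<Rightarrow> real" where
  "agm_term n = (pochhammer (1/2) n / fact n)\<^sup>2 / 2 ^ n"

lemma agm_term_Suc: "agm_term (Suc n) = agm_term n * (2 * real n + 1)\<^sup>2 / (8 * (real n + 1)\<^sup>2)"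
  by (simp add: agm_term_def pochhammer_Suc power_divide power_mult_distrib) (simp add: field_simps power2_eq_square)

lemma agm_term_nonneg: "0 \<le> agm_term n"
  by (simp add: agm_term_def)

lemma agm_ratio_le: "(2 * real n + 1)\<^sup>2 / (8 * (real n + 1)\<^sup>2) \<le> 1 / 2"
proof -
  have "(2 * real n + 1)\<^sup>2 \<le> 4 * (real n + 1)\<^sup>2"
    by (simp add: power2_eq_square algebra_simps)
  then show ?thesis by (simp add: divide_le_eq)
qed

lemma agm_term_Suc_le: "agm_term (Suc n) \<le> agm_term n / 2"
proof -
  from mult_left_mono[OF agm_ratio_le[of n] agm_term_nonneg[of n]] show ?thesis
    by (simp add: agm_term_Suc)
qed

lemma agm_term_le: "agm_term (n + k) \<le> agm_term n * (1/2) ^ k"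
proof (induction k)
  case (Suc k)
  then show ?case using agm_term_Suc_le[of "n + k"] by simp
qed simp

text \<open>Fixed-point summation rounding downwards: each term is at most half the previous one, so its
  accumulated rounding error never exceeds 2 units.\<close>

fun fixpoint_sum :: "nat \<Rightarrow> int \<Rightarrow> int \<Rightarrow> int \<Rightarrow> int" where
  "fixpoint_sum 0 n t s = s"
| "fixpoint_sum (Suc k) n t s = fixpoint_sum k (n + 1) (t * (2 * n + 1)\<^sup>2 div (8 * (n + 1)\<^sup>2)) (s + t)"

lemma fixpoint_sum_bounds:
  assumes "real_of_int t \<le> X * agm_term n" "X * agm_term n \<le> real_of_int t + 2" "0 \<le> t"
  shows "real_of_int (fixpoint_sum k (int n) t s) \<le> real_of_int s + X * (\<Sum>i<k. agm_term (n + i)) \<and>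
    real_of_int s + X * (\<Sum>i<k. agm_term (n + i)) \<le> real_of_int (fixpoint_sum k (int n) t s) + 2 * real k"
  using assms
proof (induction k arbitrary: n t s)
  case (Suc k)
  let ?r = "(2 * real n + 1)\<^sup>2 / (8 * (real n + 1)\<^sup>2)"
  let ?t = "t * (2 * int n + 1)\<^sup>2 div (8 * (int n + 1)\<^sup>2)"
  have r: "0 \<le> ?r" "?r \<le> 1 / 2"
    using agm_ratio_le by simp_all
  have "?t = \<lfloor>real_of_int (t * (2 * int n + 1)\<^sup>2) / real_of_int (8 * (int n + 1)\<^sup>2)\<rfloor>"
    by (rule floor_divide_of_int_eq[symmetric])
  also have "real_of_int (t * (2 * int n + 1)\<^sup>2) / real_of_int (8 * (int n + 1)\<^sup>2) = real_of_int t * ?r"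
    by simp
  finally have t: "real_of_int ?t \<le> real_of_int t * ?r" "real_of_int t * ?r \<le> real_of_int ?t + 1"
    by linarith+
  have X: "X * agm_term (Suc n) = X * agm_term n * ?r"
    by (simp add: agm_term_Suc)
  have "real_of_int ?t \<le> X * agm_term (Suc n)"
    unfolding X using t(1) mult_right_mono[OF Suc.prems(1) r(1)] by linarith
  \<comment> \<open>The inherited error 2 is at least halved by the ratio, and rounding down adds at
    most 1, so the bound 2 is preserved.\<close>
  moreover have "X * agm_term (Suc n) \<le> real_of_int ?t + 2"
    unfolding X using t(2) mult_right_mono[OF Suc.prems(2) r(1), unfolded distrib_right] r(2) by linarith
  moreover have "0 \<le> ?t"
    using Suc.prems(3) by (intro pos_imp_zdiv_nonneg_iff[THEN iffD2]) auto
  ultimately show ?case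
    using Suc.IH[of ?t "Suc n" "s + t"] Suc.prems
    by (simp add: sum.lessThan_Suc_shift distrib_left add.commute[of 1] del: sum.lessThan_Suc)
qed simp

text \<open>A form of the recursion equation that matches a literal counter, so that simplification
  can evaluate the sum.\<close>

lemma fixpoint_sum_numeral:
  "fixpoint_sum (numeral k) n t s = fixpoint_sum (pred_numeral k) (n + 1) (t * (2 * n + 1)\<^sup>2 div (8 * (n + 1)\<^sup>2)) (s + t)"
  by (simp add: numeral_eq_Suc)

lemma fixpoint_sum_60: "fixpoint_sum 60 0 (10 ^ 24) 0 = 1180340599016096226036276"
  by (simp add: fixpoint_sum_numeral)

lemma agm_term_summable: "summable agm_term"
proof (rule summable_comparison_test')
  show "summable (\<lambda>n. (1/2) ^ n :: real)" by (rule summable_geometric) simp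
  show "norm (agm_term n) \<le> (1/2) ^ n" if "0 \<le> n" for n
    using agm_term_le[of 0 n] agm_term_nonneg[of n] by (simp add: agm_term_def[of 0])
qed

text \<open>From index \<open>N\<close> on, the terms are dominated by a geometric series with first
  term \<open>(1/2) ^ N\<close> and ratio 1/2.\<close>

lemma agm_term_tail:
  "(\<Sum>n<N. agm_term n) \<le> suminf agm_term" "suminf agm_term \<le> (\<Sum>n<N. agm_term n) + 2 * (1/2) ^ N"
proof -
  show "(\<Sum>n<N. agm_term n) \<le> suminf agm_term"
    by (rule sum_le_suminf[OF agm_term_summable]) (simp_all add: agm_term_nonneg)
  have "agm_term N \<le> (1/2) ^ N"
    using agm_term_le[of 0 N] by (simp add: agm_term_def[of 0])
  then have "agm_term (k + N) \<le> (1/2) ^ N * (1/2) ^ k" for k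
    using agm_term_le[of N k] by (auto simp: add.commute intro: order_trans mult_right_mono)
  moreover have "(\<lambda>k. (1/2) ^ N * (1/2) ^ k) sums ((1/2) ^ N * (1 / (1 - 1/2)) :: real)"
    by (intro sums_mult geometric_sums) simp
  ultimately have "(\<Sum>k. agm_term (k + N)) \<le> (1/2) ^ N * (1 / (1 - 1/2))"
    using agm_term_summable by (intro sums_le[OF _ summable_sums]) (auto simp: summable_iff_shift)
  then show "suminf agm_term \<le> (\<Sum>n<N. agm_term n) + 2 * (1/2) ^ N"
    using suminf_split_initial_segment[OF agm_term_summable, of N] by simp
qed

text \<open>At scale 10^24 the rounding error of 60 terms is at most 120 units, about 10^(-22). The
  tail bound, below 2 * 10^(-18), dominates and fits in the stated gap.\<close>

lemma agm_series_bounds: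
  "1.180340599016096226 \<le> suminf agm_term" "suminf agm_term \<le> 1.180340599016096232"
proof -
  have 0: "fixpoint_sum 60 (int 0) (10 ^ 24) 0 = fixpoint_sum 60 0 (10 ^ 24) 0" by simp
  have "real_of_int (fixpoint_sum 60 (int 0) (10 ^ 24) 0) \<le> 10 ^ 24 * (\<Sum>n<60. agm_term n) \<and>
    10 ^ 24 * (\<Sum>n<60. agm_term n) \<le> real_of_int (fixpoint_sum 60 (int 0) (10 ^ 24) 0) + 120"
    using fixpoint_sum_bounds[of "10 ^ 24" "10 ^ 24" 0 60 0] by (simp add: agm_term_def[of 0])
  moreover have "(1/2 :: real) ^ 60 \<le> 1 / 10 ^ 18"
    by (simp add: power_divide)
  ultimately show "1.180340599016096226 \<le> suminf agm_term" "suminf agm_term \<le> 1.180340599016096232"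
    unfolding 0 fixpoint_sum_60 using agm_term_tail[of 60] by simp_all
qed

lemma agm_quotient_bounds:
  "0.8869411685781154 \<le> 2 * (suminf agm_term)\<^sup>2 / pi" "2 * (suminf agm_term)\<^sup>2 / pi < 0.8869411685781155"
proof -
  have "0.8869411685781154 * pi \<le> 0.8869411685781154 * 3.1415926535897932385" using pi_bounds by simp
  also have "\<dots> \<le> 2 * 1.180340599016096226\<^sup>2" by (simp add: power2_eq_square)
  also have "\<dots> \<le> 2 * (suminf agm_term)\<^sup>2"
    using agm_series_bounds(1) by (intro mult_left_mono power_mono) simp_all
  finally show "0.8869411685781154 \<le> 2 * (suminf agm_term)\<^sup>2 / pi" by (simp add: le_divide_eq)
  have "2 * (suminf agm_term)\<^sup>2 \<le> 2 * 1.180340599016096232\<^sup>2"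
    using agm_series_bounds by (intro mult_left_mono power_mono) simp_all
  also have "\<dots> < 0.8869411685781155 * 3.1415926535897932384" by (simp add: power2_eq_square)
  also have "\<dots> \<le> 0.8869411685781155 * pi" using pi_bounds by simp
  finally show "2 * (suminf agm_term)\<^sup>2 / pi < 0.8869411685781155" by (simp add: divide_less_eq)
qed

section \<open>The Beta value as an elliptic integral and its series\<close>

lemma inverse_sqrt_series:
  assumes "0 < y" "y < 1"
  shows "pos_powr (-1/2) (2 - y) = (\<Sum>n. ennreal (1 / sqrt 2 * (pochhammer (1/2) n / fact n) * (y / 2) ^ n))"
proof -
  \<comment> \<open>The sign of the binomial coefficient cancels that of the argument, so all terms
    are non-negative and can be integrated one by one.\<close>
  have coeff: "((-1/2) gchoose n) * (- (y / 2)) ^ n = (pochhammer (1/2) n / fact n) * (y / 2) ^ n" for n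
  proof -
    have "(- (y / 2)) ^ n = (-1) ^ n * (y / 2) ^ n" by (simp flip: power_mult_distrib)
    then show ?thesis by (simp add: gbinomial_pochhammer flip: power_mult_distrib)
  qed
  have "(\<lambda>n. ((-1/2) gchoose n) * (- (y / 2)) ^ n) sums (1 + - (y / 2)) powr (-1/2)"
    using assms by (intro gen_binomial_real) simp
  then have "(\<lambda>n. 1 / sqrt 2 * ((pochhammer (1/2) n / fact n) * (y / 2) ^ n)) sums
      (1 / sqrt 2 * (1 - y / 2) powr (-1/2))"
    unfolding coeff by (intro sums_mult) simp
  also have "1 / sqrt 2 * (1 - y / 2) powr (-1/2) = (2 - y) powr (-1/2)"
  proof -
    have "(2 - y) powr (-1/2) = (2 * (1 - y / 2)) powr (-1/2)" by simp
    also have "\<dots> = 2 powr (-(1/2)) * (1 - y / 2) powr (-1/2)"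
      using assms by (subst powr_mult) simp_all
    also have "2 powr (-(1/2)) = 1 / sqrt (2::real)"
      by (simp only: powr_minus_divide powr_half_sqrt zero_le_numeral)
    finally show ?thesis by simp
  qed
  finally have "(\<lambda>n. 1 / sqrt 2 * (pochhammer (1/2) n / fact n) * (y / 2) ^ n) sums (2 - y) powr (-1/2)"
    by (simp only: mult.assoc)
  moreover have "0 \<le> 1 / sqrt 2 * (pochhammer (1/2) n / fact n) * (y / 2) ^ n" for n :: nat
    using assms by (intro mult_nonneg_nonneg divide_nonneg_nonneg pochhammer_nonneg) simp_all
  ultimately show ?thesis
    using assms by (simp add: pos_powr_pos suminf_ennreal2 sums_iff)
qed

text \<open>Wallis' integrals: each of Gamma(n + 1/2) and Gamma(1/2) contributes a factor sqrt
  pi.\<close>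

lemma Beta_half_shift: "Beta (real n + 1/2) (1/2) = pi * (pochhammer (1/2) n / fact n)"
proof -
  have "(1/2 :: real) \<notin> \<int>\<^sub>\<le>\<^sub>0"
    using nonpos_Ints_nonpos[of "1/2 :: real"] by auto
  then have "Gamma (1/2 + real n) = pochhammer (1/2) n * sqrt pi"
    using pochhammer_Gamma[of "1/2 :: real" n] by (simp add: Gamma_one_half_real field_simps)
  then show ?thesis
    by (simp add: Beta_def Gamma_one_half_real add.commute Gamma_fact)
qed

text \<open>Putting t = y^2 in B(1/4, 1/2) gives the factor 1 - y^2 = (1 - y) (1 + y), and the
  reflection of y turns 1 + y into 2 - y. Up to a constant this is the complete elliptic integral
  with k^2 = 1/2.\<close>

lemma beta_lemniscate:
  "beta = 2 * (\<integral>\<^sup>+y. pos_powr (-1/2) y * (pos_powr (-1/2) (1 - y) * pos_powr (-1/2) (2 - y)) \<partial>lborel)"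
proof -
  let ?q = "pos_powr (-3/4)" and ?p = "pos_powr (-1/2)"
  have "beta = (\<integral>\<^sup>+t. ?q t * ?p (1 - t) \<partial>lborel)"
    unfolding beta_def by (subst nn_integral_reflect) (simp_all add: mult.commute)
  also have "\<dots> = (\<integral>\<^sup>+t. ?q t * ?p (1 - t) * indicator {0\<^sup>2..1\<^sup>2} t \<partial>lborel)"
    by (intro nn_integral_cong) (auto simp: indicator_def not_le)
  also have "\<dots> = (\<integral>\<^sup>+y. ?q (y\<^sup>2) * ?p (1 - y\<^sup>2) * ennreal (2 * y) * indicator {0..1} y \<partial>lborel)"
    by (rule nn_integral_substitution_aux[where g = "\<lambda>y. y\<^sup>2"])
      (auto intro!: derivative_eq_intros continuous_intros)
  also have "\<dots> = (\<integral>\<^sup>+y. 2 * (?p y * (?p (1 - y) * ?p (1 + y))) \<partial>lborel)"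
  proof (rule nn_integral_cong)
    fix y :: real
    show "?q (y\<^sup>2) * ?p (1 - y\<^sup>2) * ennreal (2 * y) * indicator {0..1} y = 2 * (?p y * (?p (1 - y) * ?p (1 + y)))"
    proof (cases "0 < y \<and> y < 1")
      case True
      have 1: "?p (1 - y\<^sup>2) = ?p (1 - y) * ?p (1 + y)"
        using True by (subst pos_powr_mult[symmetric]) (simp_all add: power2_eq_square algebra_simps)
      have 2: "?q (y\<^sup>2) * ennreal (2 * y) = 2 * ?p y"
      proof -
        have "y\<^sup>2 powr (-3/4) * (2 * y) = 2 * (y powr (-3/2) * y powr 1)"
          using True by (simp add: powr_powr flip: powr_numeral)
        also have "\<dots> = 2 * y powr (-1/2)"
          by (simp only: powr_add[symmetric]) simp
        finally show ?thesis
          using True by (simp add: pos_powr_pos flip: ennreal_mult' ennreal_numeral)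
      qed
      have "?q (y\<^sup>2) * ?p (1 - y\<^sup>2) * ennreal (2 * y) * indicator {0..1} y
        = (?q (y\<^sup>2) * ennreal (2 * y)) * ?p (1 - y\<^sup>2)"
        using True by (simp add: mult_ac)
      then show ?thesis unfolding 1 2 by (simp only: mult_ac)
    qed (auto simp: indicator_def)
  qed
  also have "\<dots> = 2 * (\<integral>\<^sup>+y. ?p y * (?p (1 - y) * ?p (1 + y)) \<partial>lborel)"
    by (rule nn_integral_cmult) measurable
  also have "(\<integral>\<^sup>+y. ?p y * (?p (1 - y) * ?p (1 + y)) \<partial>lborel) = (\<integral>\<^sup>+y. ?p y * (?p (1 - y) * ?p (2 - y)) \<partial>lborel)"
    by (subst nn_integral_reflect) (simp_all add: mult_ac)
  finally show ?thesis .
qed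

text \<open>Termwise integration of the binomial series in \<open>beta_lemniscate\<close>: the
  moment \<open>Beta_half_shift\<close> repeats the binomial coefficient, which accounts for the
  square in \<open>agm_term\<close>.\<close>

lemma Beta_agm_series: "Beta (1/2) (1/4) = sqrt 2 * pi * suminf agm_term"
proof -
  let ?p = "pos_powr (-1/2)"
  let ?a = "\<lambda>n. pochhammer (1/2) n / fact n :: real"
  \<comment> \<open>The exponents are kept in the form a - 1 and b - 1 so that
    \<open>nn_integral_Beta\<close> applies literally.\<close>
  have "(\<integral>\<^sup>+y. ?p y * (?p (1 - y) * ?p (2 - y)) \<partial>lborel)
    = (\<integral>\<^sup>+y. (\<Sum>n. ennreal (1 / sqrt 2 * ?a n / 2 ^ n) * (pos_powr (real n + 1/2 - 1) y * pos_powr (1/2 - 1) (1 - y))) \<partial>lborel)"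
  proof (rule nn_integral_cong)
    fix y :: real
    show "?p y * (?p (1 - y) * ?p (2 - y)) =
      (\<Sum>n. ennreal (1 / sqrt 2 * ?a n / 2 ^ n) * (pos_powr (real n + 1/2 - 1) y * pos_powr (1/2 - 1) (1 - y)))"
    proof (cases "0 < y \<and> y < 1")
      case True
      have "?p y * (?p (1 - y) * ennreal (1 / sqrt 2 * ?a n * (y / 2) ^ n))
        = ennreal (1 / sqrt 2 * ?a n / 2 ^ n) * (pos_powr (real n + 1/2 - 1) y * pos_powr (1/2 - 1) (1 - y))" for n
      proof -
        have "real n + 1/2 - 1 = real n + (-1/2)" by simp
        then have "y powr (real n + 1/2 - 1) = y ^ n * y powr (-1/2)"
          using True by (simp only: powr_add powr_realpow)
        then have eq: "y powr (-1/2) * ((1 - y) powr (-1/2) * (1 / sqrt 2 * ?a n * (y / 2) ^ n))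
          = (1 / sqrt 2 * ?a n / 2 ^ n) * (y powr (real n + 1/2 - 1) * (1 - y) powr (1/2 - 1))"
          by (simp add: power_divide mult_ac)
        have "0 \<le> 1 / sqrt 2 * ?a n / 2 ^ n"
          by (intro mult_nonneg_nonneg divide_nonneg_nonneg pochhammer_nonneg) simp_all
        moreover have "0 < y" "0 < 1 - y" using True by simp_all
        ultimately show ?thesis
          by (simp only: pos_powr_pos eq powr_ge_zero flip: ennreal_mult')
      qed
      then show ?thesis
        using True by (simp only: inverse_sqrt_series flip: ennreal_suminf_cmult)
    qed auto
  qed
  also have "\<dots> = (\<Sum>n. ennreal (1 / sqrt 2 * ?a n / 2 ^ n) * ennreal (Beta (real n + 1/2) (1/2)))"
  proof (subst nn_integral_suminf, measurable, rule suminf_cong)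
    fix n
    have eq: "(\<integral>\<^sup>+y. pos_powr (real n + 1/2 - 1) y * pos_powr (1/2 - 1) (1 - y) \<partial>lborel) = ennreal (Beta (real n + 1/2) (1/2))"
      by (rule nn_integral_Beta) simp_all
    show "(\<integral>\<^sup>+y. ennreal (1 / sqrt 2 * ?a n / 2 ^ n) * (pos_powr (real n + 1/2 - 1) y * pos_powr (1/2 - 1) (1 - y)) \<partial>lborel)
      = ennreal (1 / sqrt 2 * ?a n / 2 ^ n) * ennreal (Beta (real n + 1/2) (1/2))"
      by (subst nn_integral_cmult) (measurable, simp only: eq)
  qed
  also have "\<dots> = (\<Sum>n. ennreal (pi / sqrt 2 * agm_term n))"
  proof (rule suminf_cong)
    fix n
    have "1 / sqrt 2 * ?a n / 2 ^ n * Beta (real n + 1/2) (1/2) = pi / sqrt 2 * agm_term n"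
      by (simp add: Beta_half_shift agm_term_def power2_eq_square mult_ac)
    moreover have "0 \<le> 1 / sqrt 2 * ?a n / 2 ^ n"
      by (intro mult_nonneg_nonneg divide_nonneg_nonneg pochhammer_nonneg) simp_all
    ultimately show "ennreal (1 / sqrt 2 * ?a n / 2 ^ n) * ennreal (Beta (real n + 1/2) (1/2))
      = ennreal (pi / sqrt 2 * agm_term n)"
      by (simp only: flip: ennreal_mult')
  qed
  also have "\<dots> = ennreal (pi / sqrt 2 * suminf agm_term)"
  proof -
    have "(\<lambda>n. pi / sqrt 2 * agm_term n) sums (pi / sqrt 2 * suminf agm_term)"
      by (intro sums_mult summable_sums agm_term_summable)
    moreover have "0 \<le> pi / sqrt 2 * agm_term n" for n
      using agm_term_nonneg by simp
    ultimately show ?thesis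
      by (simp only: suminf_ennreal2 sums_iff)
  qed
  finally have "ennreal (Beta (1/2) (1/4)) = 2 * ennreal (pi / sqrt 2 * suminf agm_term)"
    using beta_lemniscate by (simp add: beta_eq)
  also have "\<dots> = ennreal (sqrt 2 * pi * suminf agm_term)"
  proof -
    have "2 * (pi / sqrt 2 * suminf agm_term) = (2 / sqrt 2) * pi * suminf agm_term" by simp
    then show ?thesis
      by (simp add: real_div_sqrt ennreal_mult'[symmetric] flip: ennreal_numeral)
  qed
  \<comment> \<open>Both sides are non-negative, by \<open>Beta_quarter\<close> and the sign of the
    terms, so the equation descends from \<open>ennreal\<close> to the reals.\<close>
  finally show ?thesis
    using suminf_nonneg[OF agm_term_summable agm_term_nonneg] by (simp add: Beta_quarter)
qed

theorem theorem8p1: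
  shows "set_integrable lborel Omega res_integrand
       \<and> C_res = Gamma (1 / 4) ^ 4 / (2 * pi ^ 4)
       \<and> C_res = 2 / Gamma (3 / 4) ^ 4
       \<and> 0.8869411685781154 \<le> C_res \<and> C_res < 0.8869411685781155"
proof -
  have "C_res = 2 * (suminf agm_term)\<^sup>2 / pi"
    unfolding C_res_Beta Beta_agm_series
    by (simp add: power_mult_distrib field_simps eval_nat_numeral)
  then show ?thesis
    using res_integrand_integral(1) C_res_Gamma_quarter C_res_Gamma_three_quarters agm_quotient_bounds
    by simp
qed

end
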